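(* Let $\lambda \in \mathbb{R}\setminus[-1,1]$, let $m\ge 1$, let $a_1,\dots,a_m \in \mathbb{C}\setminus\{0\}$ with $a_1+\cdots+a_m = |\lambda|$, let $\tau_1<\cdots<\tau_m$ be real numbers, and set $$A(y) = |\lambda|^{-1}\sum_{j=1}^m a_j e^{2\pi i \tau_j y}, \qquad y\in\mathbb{R}.$$ Let $d$ be the maximal number of elements of $\{\tau_1,\dots,\tau_m\}$ that are linearly independent over $\mathbb{Q}$, and let $P(z_1,\dots,z_d)$ be a Laurent polynomial with complex coefficients and $r_1,\dots,r_d$ real numbers such that $A(y) = P(e^{2\pi i r_1 y},\dots,e^{2\pi i r_d y})$ for all $y\in\mathbb{R}$. Then $\ln|A(y)|$ is almost periodic in the (mean squared) sense of Besicovitch, and $$\lim_{L\to\infty}\frac{1}{2L}\int_{-L}^{L}\ln|A(y)|\,dy = \ln M(P),$$ where $M(P)$ is the Mahler measure of $P$.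
   Context: The Mahler measure of a nonzero (Laurent) polynomial $P(z_1,\dots,z_d)$ is $$M(P) = \exp\int_0^1\cdots\int_0^1 \ln|P(e^{2\pi i t_1},\dots,e^{2\pi i t_d})|\,dt_1\cdots dt_d.$$ A measurable function $F:\mathbb{R}\to\mathbb{C}$ (defined almost everywhere) is almost periodic in the mean squared sense of Besicovitch if for every $\varepsilon>0$ there is a trigonometric polynomial $T(y)=\sum_{j=1}^N b_j e^{2\pi i s_j y}$ ($b_j\in\mathbb{C}$, $s_j\in\mathbb{R}$) with $\limsup_{L\to\infty}\frac{1}{2L}\int_{-L}^{L}|F(y)-T(y)|^2\,dy<\varepsilon$. Pairs $P$, $(r_1,\dots,r_d)$ as in the claim always exist, and $r_1,\dots,r_d$ are then necessarily linearly independent over $\mathbb{Q}$. *)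

theory Defs
  imports "HOL-Analysis.Analysis" "HOL-Library.Poly_Mapping"
begin

text \<open>
  The ring of complex Laurent polynomials in variables indexed by \<^typ>\<open>nat\<close> is the group
  algebra of the finitely supported exponent vectors \<^typ>\<open>nat \<Rightarrow>\<^sub>0 int\<close>.
\<close>

type_synonym laurent_poly = "(nat \<Rightarrow>\<^sub>0 int) \<Rightarrow>\<^sub>0 complex"

definition laurent_vars :: "laurent_poly \<Rightarrow> nat set" where
  "laurent_vars P = (\<Union>k\<in>Poly_Mapping.keys P. Poly_Mapping.keys k)"

definition laurent_eval :: "laurent_poly \<Rightarrow> (nat \<Rightarrow> complex) \<Rightarrow> complex" where
  "laurent_eval P z =
     (\<Sum>k\<in>Poly_Mapping.keys P. Poly_Mapping.lookup P k *
        (\<Prod>i\<in>Poly_Mapping.keys k. z i powi Poly_Mapping.lookup k i))"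

text \<open>
  The integral is taken over the cube \<open>[0,1]\<^sup>d\<close>, whose coordinates are indexed by \<open>{1..d}\<close>;
  for \<open>d = 0\<close> the product measure is the unit point mass. For nonzero \<open>P\<close> the integrand is
  integrable, so this is the iterated integral. The zeros of a nonzero \<open>P\<close> on the torus form
  a null set, so the convention \<open>ln 0 = 0\<close> has no effect.
\<close>

definition mahler_measure :: "nat \<Rightarrow> laurent_poly \<Rightarrow> real" where
  "mahler_measure d P =
     exp (\<integral>t. ln (cmod (laurent_eval P (\<lambda>i. cis (2 * pi * t i))))
            \<partial>(\<Pi>\<^sub>M i\<in>{1..d}. restrict_space lborel {0..1}))"

text \<open>
  The mean square is a nonnegative integral with values in \<^typ>\<open>ennreal\<close>, so that it is infinite
  (rather than \<open>0\<close>) when \<open>F\<close> is not square integrable. Changing \<open>F\<close> on a null set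
  affects neither condition, so a function defined almost everywhere may be extended arbitrarily.
\<close>

definition besicovitch_almost_periodic :: "(real \<Rightarrow> complex) \<Rightarrow> bool" where
  "besicovitch_almost_periodic F \<longleftrightarrow>
     F \<in> borel_measurable lebesgue \<and>
     (\<forall>\<epsilon>>0. \<exists>(N::nat) (b::nat \<Rightarrow> complex) (s::nat \<Rightarrow> real).
        Limsup at_top (\<lambda>L::real. ennreal (1 / (2 * L)) *
          (\<integral>\<^sup>+y\<in>{-L..L}. ennreal ((cmod (F y - (\<Sum>j=1..N. b j * cis (2 * pi * s j * y))))\<^sup>2)
             \<partial>lebesgue)) < ennreal \<epsilon>)"

definition rat_scale :: "rat \<Rightarrow> real \<Rightarrow> real" where
  "rat_scale q x = of_rat q * x"

global_interpretation rat_real: vector_space rat_scale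
  by unfold_locales (simp_all add: rat_scale_def algebra_simps of_rat_add of_rat_mult)

definition max_rat_independent :: "real set \<Rightarrow> nat" where
  "max_rat_independent X = Max {card S |S. S \<subseteq> X \<and> finite S \<and> rat_real.independent S}"

end

theory Submission
  imports Defs "HOL-Probability.Probability_Measure"
begin

text \<open>
  Write \<open>A(y) = F(r\<^sub>1 y, \<dots>, r\<^sub>d y)\<close> where \<open>F(t) = P(e(t\<^sub>1), \<dots>, e(t\<^sub>d))\<close> and
  \<open>e(x) = exp(2 \<pi> \<i> x)\<close>. Every frequency \<open>\<tau>\<^sub>j\<close> occurs on both sides
  of this identity, so it is an integer combination of the \<open>r\<^sub>i\<close>. As there are only \<open>d\<close> of
  the \<open>r\<^sub>i\<close>, and \<open>d\<close> of the \<open>\<tau>\<^sub>j\<close> are independent over the rationals, the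
  \<open>r\<^sub>i\<close> are independent (\<open>rationally_independent_of_dimension\<close>). The line \<open>y \<mapsto> r y\<close> is
  therefore equidistributed on the torus: a nontrivial character has mean value zero along the
  line and integral zero over the torus. By Weierstrass approximation of
  \<open>\<phi>\<close> by polynomials, the means of \<open>\<phi>(|A|\<^sup>2)\<close> converge to
  \<open>\<integral> \<phi>(|F|\<^sup>2)\<close> for every continuous \<open>\<phi>\<close> (\<open>equidistribution_norm_trig_poly\<close>), and
  \<open>\<phi>(|A|\<^sup>2)\<close> is a uniform limit of trigonometric polynomials.

  The logarithm is not continuous at zero, so everything depends on how often \<open>A\<close> is small,
  uniformly over long intervals. A polynomial in \<open>d/dy\<close> that kills all exponentials
  of \<open>A\<close> but one shows that at every point some derivative of \<open>A\<close> of order less than \<open>m\<close> has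
  modulus at least a fixed \<open>c > 0\<close> (\<open>exp_sum_jet_bounded_below\<close>). A sublevel estimate of van
  der Corput type then bounds the measure of \<open>{y \<in> [-L,L]. |A y| \<le> \<delta>}\<close>
  by \<open>2 L K \<delta>\<^bsup>1/m\<^esup>\<close> for \<open>L \<ge> 1\<close> (\<open>exp_sum_sublevel_measure\<close>). Hence a small
  negative power of \<open>|A|\<^sup>2 + \<epsilon>\<close> has means that are bounded in both \<open>L\<close> and \<open>\<epsilon>\<close>
  (\<open>exp_sum_negative_moment\<close>), and equidistribution carries this bound over to \<open>F\<close> on the torus,
  without any study of the zeros of \<open>P\<close>.

  For \<open>z > 0\<close> and \<open>0 < \<epsilon> \<le> 1\<close>, the modulus of \<open>ln z - ln (z + \<epsilon>)\<close> and its square are at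
  most a constant times
  \<open>\<epsilon>\<^bsup>s/2\<^esup> (1 + z\<^bsup>-s\<^esup>)\<close>. So replacing \<open>ln |A|\<^sup>2\<close> by \<open>ln (|A|\<^sup>2 + \<epsilon>)\<close> costs, in mean and
  in mean square, an amount that vanishes with \<open>\<epsilon>\<close> uniformly in \<open>L\<close>, and likewise on the torus
  (\<open>regularized_ln_moments\<close>). Since \<open>ln (z + \<epsilon>)\<close> is continuous for \<open>z \<ge> 0\<close>, both claims follow.
\<close>

section \<open>Sublevel sets of functions with a large derivative\<close>

lemma measure_compact_le_diameter:
  fixes S :: "real set"
  assumes "compact S" "0 \<le> D" "\<And>x y. x \<in> S \<Longrightarrow> y \<in> S \<Longrightarrow> y - x \<le> D"
  shows "measure lborel S \<le> D"
proof (cases "S = {}")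
  case False
  then obtain p q where pq: "p \<in> S" "\<And>x. x \<in> S \<Longrightarrow> p \<le> x" "q \<in> S" "\<And>x. x \<in> S \<Longrightarrow> x \<le> q"
    using compact_attains_inf[of S] compact_attains_sup[of S] assms(1) by metis
  have "measure lborel S \<le> measure lborel {p..q}"
    using pq assms(1) by (intro measure_mono_fmeasurable)
      (auto intro: fmeasurable_compact borel_compact)
  also have "\<dots> = q - p" using pq by simp
  also have "\<dots> \<le> D" using assms pq by blast
  finally show ?thesis .
qed (use assms in simp)

text \<open>
  A function whose \<open>k\<close>-th derivative is at least \<open>c\<close> cannot stay small for long. The sequence \<open>g\<close>
  lists a function with all its derivatives. In the induction step the derivative of order
  \<open>k\<close> is increasing with slope at least \<open>c\<close>, so the part of \<open>J\<close> where it is between \<open>-\<eta>\<close>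
  and \<open>\<eta>\<close> is short. The rest of \<open>J\<close> consists of two intervals, on which the
  induction hypothesis applies to \<open>g\<close> or to \<open>-g\<close>, with \<open>\<eta>\<close> in place of \<open>c\<close>.
  The sharp exponent would be \<open>1/k\<close>; the weaker \<open>1/(k + 1)\<close> makes \<open>k = 0\<close> a trivial base case.
\<close>

lemma sublevel_measure_le:
  fixes g :: "nat \<Rightarrow> real \<Rightarrow> real"
  assumes "\<And>i x. (g i has_real_derivative g (Suc i) x) (at x)"
    and "compact J" "is_interval J" "measure lborel J \<le> 1" "0 < c" "0 < \<delta>"
    and "\<And>x. x \<in> J \<Longrightarrow> c \<le> g k x"
  shows "measure lborel {x\<in>J. \<bar>g 0 x\<bar> \<le> \<delta>} \<le> (3 * 2 ^ k - 2) * (\<delta> / c) powr (1 / (real k + 1))"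
  using assms
proof (induction k arbitrary: g J c)
  case 0
  have J: "J \<in> fmeasurable lborel" using 0 by (auto intro: fmeasurable_compact)
  show ?case
  proof (cases "\<delta> < c")
    case True
    have "\<not> \<bar>g 0 x\<bar> \<le> \<delta>" if "x \<in> J" for x
      using 0(7)[OF that] True by linarith
    then have "{x\<in>J. \<bar>g 0 x\<bar> \<le> \<delta>} = {}" by blast
    then show ?thesis by (simp only: measure_empty) simp
  next
    case False
    have cont: "continuous_on UNIV (g 0)"
      using 0(1) by (intro continuous_at_imp_continuous_on) (blast intro: DERIV_isCont)
    have "closed {x. \<bar>g 0 x\<bar> \<le> \<delta>}"
      using cont by (intro closed_Collect_le continuous_intros)
    then have "compact (J \<inter> {x. \<bar>g 0 x\<bar> \<le> \<delta>})" using 0 by blast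
    then have "{x\<in>J. \<bar>g 0 x\<bar> \<le> \<delta>} \<in> sets lborel"
      by (simp add: Collect_conj_eq borel_compact)
    then have "measure lborel {x\<in>J. \<bar>g 0 x\<bar> \<le> \<delta>} \<le> measure lborel J"
      using J by (intro measure_mono_fmeasurable) auto
    also have "\<dots> \<le> 1" using 0(4) .
    also have "1 \<le> \<delta> / c" using False 0(5) by simp
    finally show ?thesis using 0 by simp
  qed
next
  case (Suc k)
  define e where "e = 1 / (real k + 2)"
  have e: "0 < e" "e < 1" by (auto simp: e_def)
  define u where "u = (\<delta> / c) powr e"
  \<comment> \<open>This choice makes the measure of the middle part and the two bounds from the
    induction hypothesis multiples of the same quantity \<open>u\<close>.\<close>
  define \<eta> where "\<eta> = c * u"
  have u: "0 < u" using Suc by (simp add: u_def)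
  have \<eta>: "0 < \<eta>" using u Suc by (simp add: \<eta>_def)
  have cont: "continuous_on UNIV (g i)" for i
    using Suc.prems(1) by (intro continuous_at_imp_continuous_on) (blast intro: DERIV_isCont)
  have mono: "c * (y - x) \<le> g k y - g k x" if "x \<in> J" "y \<in> J" "x \<le> y" for x y
  proof (cases "x = y")
    case False
    with that obtain z where z: "x < z" "z < y" "g k y - g k x = (y - x) * g (Suc k) z"
      using MVT2[of x y "g k" "g (Suc k)"] Suc.prems(1) by auto
    then have "z \<in> J" using that Suc.prems(3) unfolding is_interval_1 by (meson less_imp_le)
    then have "c * (y - x) \<le> g (Suc k) z * (y - x)"
      using Suc.prems(7) that by (intro mult_right_mono) auto
    with z show ?thesis by (simp add: mult.commute)
  qed simp
  have mono': "g k x \<le> g k y" if "x \<in> J" "y \<in> J" "x \<le> y" for x y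
    using mono[OF that] that Suc.prems(5) mult_nonneg_nonneg[of c "y - x"] by linarith
  have sub: "compact {x\<in>J. \<bar>g 0 x\<bar> \<le> \<delta> \<and> Q x}" if "closed {x. Q x}" for Q
  proof -
    have "closed {x. \<bar>g 0 x\<bar> \<le> \<delta>}"
      using cont by (intro closed_Collect_le continuous_intros)
    then have "compact (J \<inter> ({x. \<bar>g 0 x\<bar> \<le> \<delta>} \<inter> {x. Q x}))" using Suc.prems that by blast
    then show ?thesis by (simp add: Collect_conj_eq)
  qed
  have cl: "closed {x. g k x \<le> -\<eta>}" "closed {x. g k x \<ge> \<eta>}" "closed {x. \<bar>g k x\<bar> \<le> \<eta>}"
    using cont by (auto intro!: closed_Collect_le continuous_intros)
  let ?S1 = "{x\<in>J. \<bar>g 0 x\<bar> \<le> \<delta> \<and> g k x \<le> -\<eta>}"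
  let ?S2 = "{x\<in>J. \<bar>g 0 x\<bar> \<le> \<delta> \<and> g k x \<ge> \<eta>}"
  let ?S3 = "{x\<in>J. \<bar>g 0 x\<bar> \<le> \<delta> \<and> \<bar>g k x\<bar> \<le> \<eta>}"
  note comp = sub[OF cl(1)] sub[OF cl(2)] sub[OF cl(3)]
  let ?C = "3 * 2 ^ k - 2 :: real"
  have pw: "(\<delta> / \<eta>) powr (1 / (real k + 1)) = u"
  proof -
    have "\<delta> / \<eta> = (\<delta> / c) powr (1 - e)"
      using Suc.prems(5,6) by (simp add: \<eta>_def u_def powr_diff field_simps)
    moreover have "(1 - e) * (1 / (real k + 1)) = e"
      by (simp add: e_def field_simps)
    ultimately show ?thesis using Suc.prems(5,6) by (simp add: powr_powr u_def)
  qed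
  have J1: "J \<in> fmeasurable lborel" using Suc by (auto intro: fmeasurable_compact)
  have *: "compact {x\<in>J. Q x} \<and> is_interval {x\<in>J. Q x} \<and> measure lborel {x\<in>J. Q x} \<le> 1"
    if "closed {x. Q x}" "\<And>x y z. x \<in> J \<Longrightarrow> y \<in> J \<Longrightarrow> z \<in> J \<Longrightarrow> x \<le> y \<Longrightarrow> y \<le> z \<Longrightarrow> Q x \<Longrightarrow> Q z \<Longrightarrow> Q y" for Q
  proof -
    have c: "compact {x\<in>J. Q x}"
      using Suc.prems(2) that(1) by (simp add: Collect_conj_eq compact_Int_closed)
    moreover have "is_interval {x\<in>J. Q x}"
      using Suc.prems(3) that(2) unfolding is_interval_1 by blast
    moreover have "measure lborel {x\<in>J. Q x} \<le> measure lborel J"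
      using J1 c by (intro measure_mono_fmeasurable) (auto simp: borel_compact)
    ultimately show ?thesis using Suc.prems(4) by linarith
  qed
  have "measure lborel {x\<in>{x\<in>J. g k x \<ge> \<eta>}. \<bar>g 0 x\<bar> \<le> \<delta>} \<le> ?C * (\<delta> / \<eta>) powr (1 / (real k + 1))"
    using *[OF cl(2)] mono' \<eta> Suc.prems(1,6) by (intro Suc.IH) (auto intro: order_trans)
  then have m2: "measure lborel ?S2 \<le> ?C * u"
    unfolding pw by (simp add: conj_commute conj_left_commute)
  have "measure lborel {x\<in>{x\<in>J. g k x \<le> -\<eta>}. \<bar>- g 0 x\<bar> \<le> \<delta>} \<le> ?C * (\<delta> / \<eta>) powr (1 / (real k + 1))"
    using *[OF cl(1)] mono' \<eta> Suc.prems(1,6)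
    by (intro Suc.IH[where g = "\<lambda>i x. - g i x"]) (auto intro: order_trans intro!: DERIV_minus)
  then have m1: "measure lborel ?S1 \<le> ?C * u"
    unfolding pw by (simp add: conj_commute conj_left_commute)
  have m3: "measure lborel ?S3 \<le> 2 * u"
  proof (rule measure_compact_le_diameter[OF comp(3)])
    fix x y assume "x \<in> ?S3" "y \<in> ?S3"
    then have xy: "x \<in> J" "y \<in> J" "\<bar>g k x\<bar> \<le> \<eta>" "\<bar>g k y\<bar> \<le> \<eta>" by auto
    show "y - x \<le> 2 * u"
    proof (cases "x \<le> y")
      case True
      then have "c * (y - x) \<le> 2 * \<eta>" using mono[of x y] xy by linarith
      then show ?thesis using Suc.prems(5) by (simp add: \<eta>_def)
    qed (use u in auto)
  qed (use u in auto)
  have eq: "{x\<in>J. \<bar>g 0 x\<bar> \<le> \<delta>} = ?S1 \<union> (?S2 \<union> ?S3)" by auto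
  have "measure lborel (?S1 \<union> (?S2 \<union> ?S3))
      \<le> measure lborel ?S1 + measure lborel (?S2 \<union> ?S3)"
    using comp by (intro measure_Un_le) (auto intro!: borel_compact)
  moreover have "measure lborel (?S2 \<union> ?S3) \<le> measure lborel ?S2 + measure lborel ?S3"
    using comp by (intro measure_Un_le) (auto intro!: borel_compact)
  ultimately have "measure lborel {x\<in>J. \<bar>g 0 x\<bar> \<le> \<delta>} \<le> ?C * u + (?C * u + 2 * u)"
    unfolding eq using m1 m2 m3 by linarith
  also have "\<dots> = (3 * 2 ^ Suc k - 2) * u" by (simp add: algebra_simps)
  also have "u = (\<delta> / c) powr (1 / (real (Suc k) + 1))" by (simp add: u_def e_def add.commute)
  finally show ?case .
qed

section \<open>Sublevel sets of exponential sums\<close>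

definition exp_sum :: "'j set \<Rightarrow> ('j \<Rightarrow> complex) \<Rightarrow> ('j \<Rightarrow> real) \<Rightarrow> real \<Rightarrow> complex" where
  "exp_sum I a \<sigma> y = (\<Sum>j\<in>I. a j * cis (\<sigma> j * y))"

text \<open>
  The derivative of order \<open>k\<close> in closed form, so that linear combinations of
  derivatives can be computed coefficientwise.
\<close>

definition exp_sum_deriv :: "nat \<Rightarrow> 'j set \<Rightarrow> ('j \<Rightarrow> complex) \<Rightarrow> ('j \<Rightarrow> real) \<Rightarrow> real \<Rightarrow> complex" where
  "exp_sum_deriv k I a \<sigma> = exp_sum I (\<lambda>j. a j * (\<i> * of_real (\<sigma> j)) ^ k) \<sigma>"

lemma exp_sum_deriv_0 [simp]: "exp_sum_deriv 0 I a \<sigma> = exp_sum I a \<sigma>"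
  by (simp add: exp_sum_deriv_def)

lemma has_vector_derivative_exp_sum_deriv:
  "(exp_sum_deriv k I a \<sigma> has_vector_derivative exp_sum_deriv (Suc k) I a \<sigma> y) (at y)"
proof -
  have "((\<lambda>y. \<Sum>j\<in>I. a j * (\<i> * of_real (\<sigma> j)) ^ k * cis (\<sigma> j * y)) has_vector_derivative
     (\<Sum>j\<in>I. a j * (\<i> * of_real (\<sigma> j)) ^ k * (\<sigma> j *\<^sub>R (\<i> * cis (\<sigma> j * y))))) (at y)"
    by (intro has_vector_derivative_sum has_vector_derivative_mult_right)
      (auto intro!: derivative_eq_intros simp: scaleR_conv_of_real has_vector_derivative_def
        fun_eq_iff algebra_simps)
  then show ?thesis
    by (simp add: exp_sum_deriv_def exp_sum_def[abs_def] scaleR_conv_of_real algebra_simps)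
qed

lemma has_real_derivative_Re_exp_sum_deriv:
  "((\<lambda>y. Re (u * exp_sum_deriv k I a \<sigma> y)) has_real_derivative
      Re (u * exp_sum_deriv (Suc k) I a \<sigma> y)) (at y)"
  unfolding has_real_derivative_iff_has_vector_derivative
  by (intro bounded_linear.has_vector_derivative[OF bounded_linear_Re]
      has_vector_derivative_mult_right has_vector_derivative_exp_sum_deriv)

lemma norm_exp_sum_deriv_le:
  assumes "k \<le> n"
  shows "cmod (exp_sum_deriv k I a \<sigma> y) \<le> (\<Sum>j\<in>I. cmod (a j) * (1 + \<bar>\<sigma> j\<bar>) ^ n)"
proof -
  have "cmod (exp_sum_deriv k I a \<sigma> y) \<le> (\<Sum>j\<in>I. cmod (a j) * \<bar>\<sigma> j\<bar> ^ k)"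
    unfolding exp_sum_deriv_def exp_sum_def
    by (rule sum_norm_le) (simp add: norm_mult norm_power)
  also have "\<dots> \<le> (\<Sum>j\<in>I. cmod (a j) * (1 + \<bar>\<sigma> j\<bar>) ^ n)"
  proof (intro sum_mono mult_left_mono)
    fix j
    have "\<bar>\<sigma> j\<bar> ^ k \<le> (1 + \<bar>\<sigma> j\<bar>) ^ k" by (intro power_mono) auto
    also have "\<dots> \<le> (1 + \<bar>\<sigma> j\<bar>) ^ n" using assms by (intro power_increasing) auto
    finally show "\<bar>\<sigma> j\<bar> ^ k \<le> (1 + \<bar>\<sigma> j\<bar>) ^ n" .
  qed auto
  finally show ?thesis .
qed

text \<open>
  If \<open>q\<close> is a polynomial that vanishes at all \<open>\<i> \<sigma>\<^sub>j\<close> except \<open>\<i> \<sigma>\<^bsub>j0\<^esub>\<close>, then the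
  differential operator \<open>q(d/dy)\<close> turns the sum into a single term, whose modulus is a nonzero
  constant. The derivatives that occur in this combination have order less than
  the number of terms, and they cannot all be small.
\<close>

lemma exp_sum_jet_bounded_below:
  assumes "finite I" "inj_on \<sigma> I" "j0 \<in> I" "a j0 \<noteq> 0"
  obtains c where "0 < c" "\<And>y. \<exists>k<card I. c \<le> cmod (exp_sum_deriv k I a \<sigma> y)"
proof -
  define q where "q = (\<Prod>j\<in>I - {j0}. [:- (\<i> * of_real (\<sigma> j)), 1:])"
  have deg: "degree q = card I - 1"
    using assms by (simp add: q_def degree_prod_sum_eq card_Diff_singleton)
  have I: "card I > 0" using assms by (auto simp: card_gt_0_iff)
  have root: "poly q (\<i> * of_real (\<sigma> j)) = 0" if "j \<in> I" "j \<noteq> j0" for j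
    unfolding q_def poly_prod using that assms(1) by (intro prod_zero) auto
  have nz: "poly q (\<i> * of_real (\<sigma> j0)) \<noteq> 0"
    using assms by (auto simp: q_def poly_prod inj_on_def)
  define B where "B = (\<Sum>k<card I. cmod (coeff q k))"
  have B: "0 \<le> B" by (simp add: B_def sum_nonneg)
  define v where "v = cmod (a j0 * poly q (\<i> * of_real (\<sigma> j0)))"
  have v: "v > 0" using nz assms by (simp add: v_def)
  have eq: "(\<Sum>k<card I. coeff q k * exp_sum_deriv k I a \<sigma> y)
      = a j0 * poly q (\<i> * of_real (\<sigma> j0)) * cis (\<sigma> j0 * y)" for y
  proof -
    have "(\<Sum>k<card I. coeff q k * exp_sum_deriv k I a \<sigma> y)
        = (\<Sum>j\<in>I. a j * (\<Sum>k<card I. coeff q k * (\<i> * of_real (\<sigma> j)) ^ k) * cis (\<sigma> j * y))"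
      unfolding exp_sum_deriv_def exp_sum_def sum_distrib_left sum_distrib_right
      by (subst sum.swap) (intro sum.cong refl, simp add: ac_simps)
    also have "\<dots> = (\<Sum>j\<in>I. a j * poly q (\<i> * of_real (\<sigma> j)) * cis (\<sigma> j * y))"
    proof -
      have "{..<card I} = {..degree q}" using deg I by auto
      then show ?thesis by (simp add: poly_altdef)
    qed
    also have "\<dots> = (\<Sum>j\<in>{j0}. a j * poly q (\<i> * of_real (\<sigma> j)) * cis (\<sigma> j * y))"
      using assms root by (intro sum.mono_neutral_right) auto
    finally show ?thesis by simp
  qed
  show ?thesis
  proof
    show "0 < v / (1 + B)" using v B by simp
    fix y
    show "\<exists>k<card I. v / (1 + B) \<le> cmod (exp_sum_deriv k I a \<sigma> y)"
    proof (rule ccontr)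
      assume "\<not> ?thesis"
      then have "cmod (exp_sum_deriv k I a \<sigma> y) \<le> v / (1 + B)" if "k < card I" for k
        using that by (meson less_eq_real_def not_le)
      then have "cmod (\<Sum>k<card I. coeff q k * exp_sum_deriv k I a \<sigma> y)
          \<le> (\<Sum>k<card I. cmod (coeff q k) * (v / (1 + B)))"
        by (intro sum_norm_le) (auto simp: norm_mult simp del: times_divide_eq_right intro!: mult_left_mono)
      also have "\<dots> = B * (v / (1 + B))" by (simp only: B_def sum_distrib_right)
      also have "\<dots> < v" using v B by (simp add: field_simps)
      finally show False by (simp add: eq v_def norm_mult)
    qed
  qed
qed

lemma continuous_on_exp_sum: "continuous_on S (exp_sum I a \<sigma>)"
  unfolding exp_sum_def[abs_def] by (intro continuous_intros)

text \<open>
  At the left end of the interval some derivative of order less than the number of terms is at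
  least \<open>c\<close> in modulus. Rotating the sum by a unit \<open>u\<close> makes that derivative positive there.
  The next derivative is bounded on the whole line, so on an interval of a
  fixed length \<open>\<rho>\<close> the real part of the rotated derivative stays above \<open>c / 2\<close>,
  and the real part of the rotated sum satisfies the hypothesis of the sublevel estimate.
\<close>

lemma exp_sum_sublevel_measure_short_interval:
  assumes "finite I" "inj_on \<sigma> I" "j0 \<in> I" "a j0 \<noteq> 0"
  obtains \<rho> K where "0 < \<rho>" "0 \<le> K"
    "\<And>x \<delta>. 0 < \<delta> \<Longrightarrow> measure lborel {y\<in>{x..x+\<rho>}. cmod (exp_sum I a \<sigma> y) \<le> \<delta>}
        \<le> K * \<delta> powr (1 / real (card I))"
proof -
  define m where "m = card I"
  have m: "m > 0" using assms by (auto simp: card_gt_0_iff m_def)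
  obtain c where c: "0 < c" "\<And>y. \<exists>k<m. c \<le> cmod (exp_sum_deriv k I a \<sigma> y)"
    by (rule exp_sum_jet_bounded_below[where a = a, OF assms]) (rule that, simp_all only: m_def)
  define \<Lambda> where "\<Lambda> = (\<Sum>j\<in>I. cmod (a j) * (1 + \<bar>\<sigma> j\<bar>) ^ m)"
  have \<Lambda>: "0 \<le> \<Lambda>" by (auto simp: \<Lambda>_def intro!: sum_nonneg)
  define \<rho> where "\<rho> = min 1 (c / (2 * (\<Lambda> + 1)))"
  have \<rho>: "0 < \<rho>" "\<rho> \<le> 1" "\<Lambda> * \<rho> \<le> c / 2"
  proof -
    show "0 < \<rho>" "\<rho> \<le> 1" using c \<Lambda> by (auto simp: \<rho>_def)
    have "\<Lambda> * \<rho> \<le> (\<Lambda> + 1) * (c / (2 * (\<Lambda> + 1)))"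
      using \<Lambda> c by (intro mult_mono) (auto simp: \<rho>_def)
    also have "\<dots> = c / 2" using \<Lambda> by (simp add: divide_simps)
    finally show "\<Lambda> * \<rho> \<le> c / 2" .
  qed
  define K where "K = 3 * 2 ^ m * (2 / c) powr (1 / m)"
  show ?thesis
  proof
    show "0 < \<rho>" by fact
    show "0 \<le> K" by (simp add: K_def)
    fix x \<delta> :: real assume \<delta>: "0 < \<delta>"
    let ?E = "{y\<in>{x..x+\<rho>}. cmod (exp_sum I a \<sigma> y) \<le> \<delta>}"
    have Kd: "K * \<delta> powr (1 / m) = 3 * 2 ^ m * (\<delta> / (c / 2)) powr (1 / m)"
      using \<delta> c by (simp add: K_def powr_mult[symmetric] mult.assoc field_simps)
    have comp: "compact {y\<in>{x..x+\<rho>}. h y \<le> \<delta>}" if "continuous_on UNIV h" for h :: "real \<Rightarrow> real"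
    proof -
      have "closed {y. h y \<le> \<delta>}" using that by (intro closed_Collect_le continuous_intros)
      then have "compact ({x..x+\<rho>} \<inter> {y. h y \<le> \<delta>})" by blast
      then show ?thesis by (simp only: Collect_conj_eq Collect_mem_eq)
    qed
    have compE: "compact ?E" by (intro comp continuous_intros continuous_on_exp_sum)
    show "measure lborel ?E \<le> K * \<delta> powr (1 / card I)"
    \<comment> \<open>The order \<open>k\<close> depends on \<open>x\<close>; the exponent \<open>1 / m\<close> serves all \<open>k < m\<close> as long as
      the base is at most 1, and otherwise the claim exceeds the length of the interval.\<close>
    proof (cases "\<delta> / (c / 2) \<le> 1")
      case True
      obtain k where k: "k < m" "c \<le> cmod (exp_sum_deriv k I a \<sigma> x)" using c by blast
      define f where "f = exp_sum_deriv k I a \<sigma> x"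
      define u where "u = cnj (sgn f)"
      have f0: "f \<noteq> 0" using k c by (auto simp: f_def)
      then have u: "cmod u = 1" by (simp add: u_def norm_sgn)
      have uf: "Re (u * f) = cmod f"
      proof -
        have "u * f = of_real (cmod f)"
          using f0 by (simp add: u_def sgn_eq complex_norm_square[symmetric] power2_eq_square
              mult.commute[of "cnj f"])
        then show ?thesis by simp
      qed
      define g where "g = (\<lambda>i y. Re (u * exp_sum_deriv i I a \<sigma> y))"
      have deriv: "(g i has_real_derivative g (Suc i) y) (at y)" for i y
        unfolding g_def by (rule has_real_derivative_Re_exp_sum_deriv)
      have gle: "\<bar>g i y\<bar> \<le> cmod (exp_sum_deriv i I a \<sigma> y)" for i y
        using abs_Re_le_cmod[of "u * exp_sum_deriv i I a \<sigma> y"] u by (simp add: g_def norm_mult)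
      have low: "c / 2 \<le> g k y" if y: "y \<in> {x..x+\<rho>}" for y
      proof -
        have "norm (g k y - g k x) \<le> \<Lambda> * norm (y - x)"
        proof (rule field_differentiable_bound[where S = UNIV and f' = "g (Suc k)"])
          show "norm (g (Suc k) z) \<le> \<Lambda>" for z
            using gle[of "Suc k" z] norm_exp_sum_deriv_le[of "Suc k" m I a \<sigma> z] k
            unfolding \<Lambda>_def real_norm_def by linarith
        qed (use deriv in auto)
        also have "\<dots> \<le> \<Lambda> * \<rho>" using y \<Lambda> by (intro mult_left_mono) auto
        finally have "\<bar>g k y - g k x\<bar> \<le> c / 2" using \<rho> by simp
        moreover have "c \<le> g k x" using k uf by (simp add: g_def f_def)
        ultimately show ?thesis by linarith
      qed
      have "continuous_on UNIV (g 0)"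
        using deriv by (intro continuous_at_imp_continuous_on) (blast intro: DERIV_isCont)
      then have comp0: "compact {y\<in>{x..x+\<rho>}. \<bar>g 0 y\<bar> \<le> \<delta>}"
        by (intro comp continuous_intros)
      have "measure lborel ?E \<le> measure lborel {y\<in>{x..x+\<rho>}. \<bar>g 0 y\<bar> \<le> \<delta>}"
        using comp0 compE gle[of 0]
        by (intro measure_mono_fmeasurable) (auto intro: fmeasurable_compact borel_compact order_trans)
      also have "\<dots> \<le> (3 * 2 ^ k - 2) * (\<delta> / (c / 2)) powr (1 / (real k + 1))"
        using \<delta> c \<rho> low deriv by (intro sublevel_measure_le) (auto simp: is_interval_cc)
      also have "\<dots> \<le> (3 * 2 ^ m) * (\<delta> / (c / 2)) powr (1 / m)"
      proof (intro mult_mono)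
        show "(\<delta> / (c / 2)) powr (1 / (real k + 1)) \<le> (\<delta> / (c / 2)) powr (1 / m)"
          using True \<delta> c k by (intro powr_mono') (auto simp: field_simps)
        have "(2::real) ^ k \<le> 2 ^ m" using k by (intro power_increasing) auto
        then show "3 * 2 ^ k - 2 \<le> (3 * 2 ^ m :: real)" by linarith
      qed auto
      finally show ?thesis using Kd by (simp add: m_def)
    next
      case False
      have "measure lborel ?E \<le> measure lborel {x..x+\<rho>}"
        using compE by (intro measure_mono_fmeasurable) (auto intro: borel_compact fmeasurable_compact)
      also have "\<dots> \<le> 1 * 1" using \<rho> by simp
      also have "\<dots> \<le> 3 * 2 ^ m * (\<delta> / (c / 2)) powr (1 / m)"
      proof (intro mult_mono)
        show "1 \<le> (\<delta> / (c / 2)) powr (1 / real m)" using False by (intro ge_one_powr_ge_zero) auto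
        show "(1::real) \<le> 3 * 2 ^ m" using one_le_power[of "2::real" m] by linarith
      qed auto
      finally show ?thesis using Kd by (simp add: m_def)
    qed
  qed
qed

text \<open>
  The interval \<open>[-L, L]\<close> is covered by at most a constant multiple of \<open>L\<close> intervals of
  length \<open>\<rho>\<close>, and the bound on each of them does not depend on its position.
\<close>

lemma exp_sum_sublevel_measure:
  assumes "finite I" "inj_on \<sigma> I" "j0 \<in> I" "a j0 \<noteq> 0"
  obtains K where "0 \<le> K"
    "\<And>L \<delta>. 1 \<le> L \<Longrightarrow> 0 < \<delta> \<Longrightarrow> measure lborel {y\<in>{-L..L}. cmod (exp_sum I a \<sigma> y) \<le> \<delta>}
        \<le> 2 * L * (K * \<delta> powr (1 / real (card I)))"
proof -
  obtain \<rho> K where \<rho>: "0 < \<rho>" and K: "0 \<le> K" and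
    short: "\<And>x \<delta>. 0 < \<delta> \<Longrightarrow> measure lborel {y\<in>{x..x+\<rho>}. cmod (exp_sum I a \<sigma> y) \<le> \<delta>}
        \<le> K * \<delta> powr (1 / real (card I))"
    by (rule exp_sum_sublevel_measure_short_interval[where a = a, OF assms]) (rule that)
  show ?thesis
  proof
    show "0 \<le> (1 / \<rho> + 2) * K" using \<rho> K by simp
    fix L \<delta> :: real assume L: "1 \<le> L" and \<delta>: "0 < \<delta>"
    define N where "N = nat \<lceil>2 * L / \<rho>\<rceil>"
    have "real N \<le> 2 * L / \<rho> + 1" using L \<rho> by (simp add: N_def)
    also have "\<dots> \<le> 2 * L * (1 / \<rho> + 1)" using L by (simp add: algebra_simps)
    finally have N: "real N \<le> 2 * L * (1 / \<rho> + 1)" .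
    have comp: "compact {y\<in>{p..q}. cmod (exp_sum I a \<sigma> y) \<le> \<delta>}" for p q
    proof -
      have "closed {y. cmod (exp_sum I a \<sigma> y) \<le> \<delta>}"
        by (intro closed_Collect_le continuous_intros continuous_on_exp_sum)
      then have "compact ({p..q} \<inter> {y. cmod (exp_sum I a \<sigma> y) \<le> \<delta>})" by blast
      then show ?thesis by (simp only: Collect_conj_eq Collect_mem_eq)
    qed
    let ?E = "\<lambda>n::nat. {y\<in>{-L + n * \<rho>..-L + n * \<rho> + \<rho>}. cmod (exp_sum I a \<sigma> y) \<le> \<delta>}"
    have cover: "{y\<in>{-L..L}. cmod (exp_sum I a \<sigma> y) \<le> \<delta>} \<subseteq> (\<Union>n\<in>{..<Suc N}. ?E n)"
    proof
      fix y assume y: "y \<in> {y\<in>{-L..L}. cmod (exp_sum I a \<sigma> y) \<le> \<delta>}"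
      define n where "n = nat \<lfloor>(y + L) / \<rho>\<rfloor>"
      have nn: "0 \<le> (y + L) / \<rho>" using y \<rho> by simp
      have n1: "real n \<le> (y + L) / \<rho>" "(y + L) / \<rho> < real n + 1"
        using nn unfolding n_def by linarith+
      have "(y + L) / \<rho> \<le> 2 * L / \<rho>" using y \<rho> by (intro divide_right_mono) auto
      then have "n \<le> N" unfolding n_def N_def using nn by linarith
      moreover have "y \<in> ?E n" using n1 y \<rho> by (simp add: field_simps)
      ultimately show "y \<in> (\<Union>n\<in>{..<Suc N}. ?E n)" by fastforce
    qed
    have "measure lborel {y\<in>{-L..L}. cmod (exp_sum I a \<sigma> y) \<le> \<delta>} \<le> measure lborel (\<Union>n\<in>{..<Suc N}. ?E n)"
      using cover comp
      by (intro measure_mono_fmeasurable) (auto intro!: fmeasurable_compact borel_compact compact_UN)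
    also have "\<dots> \<le> (\<Sum>n<Suc N. measure lborel (?E n))"
      using comp by (intro measure_UNION_le) (auto intro!: borel_compact)
    also have "\<dots> \<le> (\<Sum>n<Suc N. K * \<delta> powr (1 / real (card I)))"
      by (intro sum_mono short \<delta>)
    also have "\<dots> = real (Suc N) * (K * \<delta> powr (1 / real (card I)))" by simp
    also have "\<dots> \<le> (2 * L * (1 / \<rho> + 2)) * (K * \<delta> powr (1 / real (card I)))"
      using N K L by (intro mult_right_mono) (auto simp: algebra_simps)
    finally show "measure lborel {y\<in>{-L..L}. cmod (exp_sum I a \<sigma> y) \<le> \<delta>}
      \<le> 2 * L * ((1 / \<rho> + 2) * K * \<delta> powr (1 / real (card I)))" by (simp add: mult.assoc)
  qed
qed

section \<open>Mean values over long intervals\<close>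

text \<open>
  Averaging over \<open>[-L, L]\<close> is integration against a probability measure, so the same lemmas
  apply to averages along the line and to integrals over the torus.
\<close>

abbreviation mean_measure :: "real \<Rightarrow> real measure" where
  "mean_measure L \<equiv> uniform_measure lborel {-L..L}"

lemma prob_space_mean_measure: "0 < L \<Longrightarrow> prob_space (mean_measure L)"
  by (intro prob_space_uniform_measure) auto

lemma borel_measurable_mean_measure:
  "f \<in> borel_measurable borel \<Longrightarrow> f \<in> borel_measurable (mean_measure L)"
  by simp

lemma nn_integral_mean_measure:
  assumes "0 < L" and [measurable]: "f \<in> borel_measurable borel"
  shows "(\<integral>\<^sup>+y. f y \<partial>mean_measure L) = ennreal (1 / (2 * L)) * (\<integral>\<^sup>+y\<in>{-L..L}. f y \<partial>lborel)"
proof -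
  have "inverse (ennreal (2 * L)) = ennreal (1 / (2 * L))"
    using assms by (simp add: inverse_ennreal inverse_eq_divide)
  then show ?thesis
    using assms by (simp add: nn_integral_uniform_measure divide_ennreal_def mult.commute)
qed

lemma integral_mean_measure:
  fixes f :: "real \<Rightarrow> 'a::{banach, second_countable_topology}"
  assumes L: "0 < L" and [measurable]: "f \<in> borel_measurable borel"
  shows "(\<integral>y. f y \<partial>mean_measure L) = (1 / (2 * L)) *\<^sub>R (LINT y:{-L..L}|lborel. f y)"
proof -
  have "mean_measure L = density lborel (\<lambda>y. ennreal (indicator {-L..L} y / (2 * L)))"
    unfolding uniform_measure_def using L
    by (intro density_cong) (auto simp: indicator_def divide_ennreal ennreal_1[symmetric] simp del: ennreal_1)
  then have "(\<integral>y. f y \<partial>mean_measure L) = (\<integral>y. (indicator {-L..L} y / (2 * L)) *\<^sub>R f y \<partial>lborel)"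
    using L by (simp add: integral_density)
  also have "\<dots> = (\<integral>y. (1 / (2 * L)) *\<^sub>R (indicator {-L..L} y *\<^sub>R f y) \<partial>lborel)"
    by (simp add: mult.commute)
  finally show ?thesis unfolding set_lebesgue_integral_def by (simp only: integral_scaleR_right)
qed

lemma borel_measurable_cis [measurable]: "(\<lambda>x. cis x) \<in> borel_measurable borel"
  by (intro borel_measurable_continuous_onI continuous_intros)

lemma integral_cis_Icc:
  fixes s :: real
  assumes "s \<noteq> 0" "a \<le> b"
  shows "(LINT y:{a..b}|lborel. cis (s * y)) = (cis (s * b) - cis (s * a)) / (\<i> * of_real s)"
proof -
  have "(\<integral>y. indicator {a..b} y *\<^sub>R cis (s * y) \<partial>lborel)
      = cis (s * b) / (\<i> * of_real s) - cis (s * a) / (\<i> * of_real s)"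
  proof (rule integral_FTC_Icc[OF assms(2)])
    fix x
    show "((\<lambda>y. cis (s * y) / (\<i> * of_real s)) has_vector_derivative cis (s * x)) (at x within {a..b})"
      unfolding has_vector_derivative_def using assms
      by (auto intro!: derivative_eq_intros simp: fun_eq_iff scaleR_conv_of_real field_simps)
  qed (intro continuous_intros)
  then show ?thesis by (simp add: set_lebesgue_integral_def diff_divide_distrib)
qed

lemma integrable_prob_space_bounded:
  fixes f :: "'a \<Rightarrow> 'b::{banach, second_countable_topology}"
  assumes "prob_space M" "f \<in> borel_measurable M" "\<And>x. norm (f x) \<le> B"
  shows "integrable M f"
proof -
  interpret prob_space M by fact
  show ?thesis using assms by (intro integrable_const_bound[where B = B]) auto
qed

lemma mean_value_cis:
  "((\<lambda>L. \<integral>y. cis (s * y) \<partial>mean_measure L) \<longlongrightarrow> (if s = 0 then 1 else 0)) at_top"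
proof (cases "s = 0")
  case True
  have "\<forall>\<^sub>F L in at_top. (\<integral>y. cis (s * y) \<partial>mean_measure L) = 1"
    using eventually_gt_at_top[of 0]
  proof eventually_elim
    case (elim L)
    interpret prob_space "mean_measure L" using prob_space_mean_measure[OF elim] .
    show ?case using True prob_space by simp
  qed
  then show ?thesis using True by (simp add: tendsto_eventually)
next
  case False
  have lim: "((\<lambda>L. (1 / \<bar>s\<bar>) * (1 / L)) \<longlongrightarrow> (1 / \<bar>s\<bar>) * 0) at_top"
    by (intro tendsto_intros tendsto_divide_0[OF tendsto_const] filterlim_at_top_imp_at_infinity filterlim_ident)
  have "\<forall>\<^sub>F L in at_top. norm (\<integral>y. cis (s * y) \<partial>mean_measure L) \<le> (1 / \<bar>s\<bar>) * (1 / L)"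
    using eventually_gt_at_top[of 0]
  proof eventually_elim
    case (elim L)
    have "norm (\<integral>y. cis (s * y) \<partial>mean_measure L)
        = 1 / (2 * L) * (norm (cis (s * L) - cis (s * - L)) / \<bar>s\<bar>)"
      using elim False by (simp add: integral_mean_measure integral_cis_Icc norm_divide norm_mult)
    also have "\<dots> \<le> 1 / (2 * L) * ((1 + 1) / \<bar>s\<bar>)"
      using elim norm_triangle_ineq4[of "cis (s * L)" "cis (s * - L)"]
      by (intro mult_left_mono divide_right_mono) auto
    finally show ?case by (simp add: mult.commute)
  qed
  then have "((\<lambda>L. \<integral>y. cis (s * y) \<partial>mean_measure L) \<longlongrightarrow> 0) at_top"
    using lim unfolding mult_zero_right by (rule Lim_null_comparison)
  with False show ?thesis by simp
qed

lemma mean_value_exp_sum: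
  assumes "finite J"
  shows "((\<lambda>L. \<integral>y. (\<Sum>j\<in>J. c j * cis (s j * y)) \<partial>mean_measure L)
    \<longlongrightarrow> (\<Sum>j\<in>J. if s j = 0 then c j else 0)) at_top"
proof -
  have "((\<lambda>L. \<Sum>j\<in>J. c j * (\<integral>y. cis (s j * y) \<partial>mean_measure L))
      \<longlongrightarrow> (\<Sum>j\<in>J. c j * (if s j = 0 then 1 else 0))) at_top"
    by (intro tendsto_intros mean_value_cis)
  also have "(\<Sum>j\<in>J. c j * (if s j = 0 then 1 else 0)) = (\<Sum>j\<in>J. if s j = 0 then c j else 0)"
    by (intro sum.cong) auto
  finally show ?thesis
  proof (rule Lim_transform_eventually)
    show "\<forall>\<^sub>F L in at_top. (\<Sum>j\<in>J. c j * (\<integral>y. cis (s j * y) \<partial>mean_measure L))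
        = (\<integral>y. (\<Sum>j\<in>J. c j * cis (s j * y)) \<partial>mean_measure L)"
      using eventually_gt_at_top[of 0]
    proof eventually_elim
      case (elim L)
      have "integrable (mean_measure L) (\<lambda>y. cis (s j * y))" for j
        by (rule integrable_prob_space_bounded[OF prob_space_mean_measure[OF elim], where B = 1]) auto
      then show ?case by (simp add: Bochner_Integration.integral_sum)
    qed
  qed
qed

section \<open>Trigonometric polynomials on the torus and equidistribution\<close>

abbreviation torus_measure :: "nat set \<Rightarrow> (nat \<Rightarrow> real) measure" where
  "torus_measure I \<equiv> (\<Pi>\<^sub>M i\<in>I. restrict_space lborel {0..1})"

lemma prob_space_unit_interval: "prob_space (restrict_space lborel {0..1::real})"
  by (intro prob_space_restrict_space) auto

lemma prob_space_torus_measure: 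
  assumes "finite I" shows "prob_space (torus_measure I)"
proof -
  interpret finite_product_prob_space "\<lambda>_. restrict_space lborel {0..1::real}" I
    using assms prob_space_unit_interval
    by (intro finite_product_prob_space.intro product_prob_spaceI finite_product_sigma_finite.intro
        finite_product_sigma_finite_axioms.intro product_prob_space.axioms)
  show ?thesis by (rule prob_space_axioms)
qed

lemma measurable_torus_component:
  "i \<in> I \<Longrightarrow> (\<lambda>t. t i) \<in> borel_measurable (torus_measure I)"
  by (rule measurable_compose[OF measurable_component_singleton]) 
    (auto intro: measurable_restrict_space1)

lemma integral_torus_character:
  fixes k :: "nat \<Rightarrow> int"
  assumes "finite I"
  shows "(\<integral>t. cis (2 * pi * (\<Sum>i\<in>I. of_int (k i) * t i)) \<partial>torus_measure I)
    = (if \<forall>i\<in>I. k i = 0 then 1 else 0)"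
proof -
  interpret product_prob_space "\<lambda>_. restrict_space lborel {0..1::real}" I
    by (rule product_prob_spaceI) (rule prob_space_unit_interval)
  let ?e = "\<lambda>i x. cis (2 * pi * of_int (k i) * x)"
  have one: "(\<integral>x. ?e i x \<partial>restrict_space lborel {0..1::real}) = (if k i = 0 then 1 else 0)" for i
  proof (cases "k i = 0")
    case True
    then show ?thesis using prob_space.prob_space[OF prob_space_unit_interval] by simp
  next
    case False
    have "(\<integral>x. ?e i x \<partial>restrict_space lborel {0..1::real}) = (LINT x:{0..1}|lborel. ?e i x)"
      by (subst integral_restrict_space) (auto simp: set_lebesgue_integral_def)
    also have "\<dots> = 0" using False by (subst integral_cis_Icc) (auto simp: cis_multiple_2pi)
    finally show ?thesis using False by simp
  qed
  have int: "integrable (restrict_space lborel {0..1::real}) (?e i)" for i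
    by (rule integrable_prob_space_bounded[OF prob_space_unit_interval, where B = 1])
      (auto intro!: measurable_restrict_space1)
  have "cis (2 * pi * (\<Sum>i\<in>I. of_int (k i) * t i)) = (\<Prod>i\<in>I. ?e i (t i))" for t :: "nat \<Rightarrow> real"
    using assms by (induction I) (auto simp: distrib_left cis_mult[symmetric] mult.assoc)
  then have "(\<integral>t. cis (2 * pi * (\<Sum>i\<in>I. of_int (k i) * t i)) \<partial>torus_measure I)
      = (\<integral>t. (\<Prod>i\<in>I. ?e i (t i)) \<partial>torus_measure I)" by simp
  also have "\<dots> = (\<Prod>i\<in>I. \<integral>x. ?e i x \<partial>restrict_space lborel {0..1::real})"
    by (rule product_integral_prod[OF assms int])
  also have "\<dots> = (if \<forall>i\<in>I. k i = 0 then 1 else 0)"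
    using assms by (auto simp: one intro!: prod.neutral prod_zero)
  finally show ?thesis .
qed

inductive torus_trig_poly :: "nat set \<Rightarrow> ((nat \<Rightarrow> real) \<Rightarrow> complex) \<Rightarrow> bool" for I where
  character: "torus_trig_poly I (\<lambda>t. c * cis (2 * pi * (\<Sum>i\<in>I. of_int (k i) * t i)))" for k :: "nat \<Rightarrow> int"
| add: "torus_trig_poly I F \<Longrightarrow> torus_trig_poly I G \<Longrightarrow> torus_trig_poly I (\<lambda>t. F t + G t)"

lemma torus_trig_poly_const: "torus_trig_poly I (\<lambda>t. c)"
  using torus_trig_poly.character[where c = c and k = "\<lambda>_. 0"] by simp

lemma torus_trig_poly_sum:
  "(\<And>j. j \<in> J \<Longrightarrow> torus_trig_poly I (F j)) \<Longrightarrow> torus_trig_poly I (\<lambda>t. \<Sum>j\<in>J. F j t)"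
  by (induction J rule: infinite_finite_induct)
    (auto intro: torus_trig_poly_const torus_trig_poly.add)

lemma torus_trig_poly_cnj: "torus_trig_poly I F \<Longrightarrow> torus_trig_poly I (\<lambda>t. cnj (F t))"
proof (induction rule: torus_trig_poly.induct)
  case (character k c)
  show ?case using torus_trig_poly.character[where c = "cnj c" and k = "\<lambda>i. - k i"]
    by (simp add: cis_cnj sum_negf)
qed (auto intro: torus_trig_poly.add)

lemma torus_trig_poly_mult:
  assumes "torus_trig_poly I F" "torus_trig_poly I G"
  shows "torus_trig_poly I (\<lambda>t. F t * G t)"
  using assms
proof (induction rule: torus_trig_poly.induct)
  case (character k c)
  from character show ?case
  proof (induction rule: torus_trig_poly.induct)
    case (character k' c')
    have "cis (2 * pi * (\<Sum>i\<in>I. of_int (k i) * t i)) * cis (2 * pi * (\<Sum>i\<in>I. of_int (k' i) * t i))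
        = cis (2 * pi * (\<Sum>i\<in>I. of_int (k i + k' i) * t i))" for t :: "nat \<Rightarrow> real"
      by (simp add: cis_mult sum.distrib distrib_right distrib_left)
    then show ?case using torus_trig_poly.character[where c = "c * c'" and k = "\<lambda>i. k i + k' i"]
      by (simp add: ac_simps)
  qed (auto simp: distrib_left intro: torus_trig_poly.add)
qed (auto simp: distrib_right intro: torus_trig_poly.add)

text \<open>
  The class is an algebra closed under conjugation and contains \<open>|F|\<^sup>2 = F * cnj F\<close>. This is what
  makes Weierstrass approximation in one real variable sufficient on the torus.
\<close>

lemma torus_trig_poly_polynomial_norm:
  assumes "torus_trig_poly I F" "real_polynomial_function q"
  shows "torus_trig_poly I (\<lambda>t. of_real (q ((cmod (F t))\<^sup>2)))"
  using assms(2)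
proof (induction rule: real_polynomial_function.induct)
  case (linear f)
  have "f x = x * f 1" for x
    using linear_scale[OF bounded_linear.linear[OF linear], of x 1] by simp
  then have "(\<lambda>t. of_real (f ((cmod (F t))\<^sup>2))) = (\<lambda>t. (F t * cnj (F t)) * of_real (f 1))"
    by (metis complex_norm_square of_real_mult of_real_power)
  then show ?case
    using torus_trig_poly_mult[OF torus_trig_poly_mult[OF assms(1) torus_trig_poly_cnj[OF assms(1)]]
        torus_trig_poly_const] by simp
qed (auto intro: torus_trig_poly_const torus_trig_poly.add torus_trig_poly_mult)

lemma torus_trig_poly_bounded: "torus_trig_poly I F \<Longrightarrow> \<exists>B. \<forall>t. cmod (F t) \<le> B"
proof (induction rule: torus_trig_poly.induct)
  case (character k c)
  show ?case by (auto simp: norm_mult)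
next
  case (add F G)
  then obtain B C where "\<And>t. cmod (F t) \<le> B" "\<And>t. cmod (G t) \<le> C" by blast
  then have "cmod (F t + G t) \<le> B + C" for t by (intro norm_triangle_mono)
  then show ?case by blast
qed

lemma torus_trig_poly_measurable:
  "torus_trig_poly I F \<Longrightarrow> F \<in> borel_measurable (torus_measure I)"
proof (induction rule: torus_trig_poly.induct)
  case (character k c)
  show ?case
    by (intro borel_measurable_times borel_measurable_const borel_measurable_sum
        measurable_compose[OF _ borel_measurable_cis] measurable_torus_component)
qed (rule borel_measurable_add)

lemma torus_trig_poly_flow_measurable:
  "torus_trig_poly I F \<Longrightarrow> (\<lambda>y. F (\<lambda>i. r i * y)) \<in> borel_measurable borel"
  by (induction rule: torus_trig_poly.induct) auto

lemma torus_trig_poly_flow: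
  assumes "torus_trig_poly I F"
  shows "\<exists>(N::nat) b s. \<forall>y. F (\<lambda>i. r i * y) = (\<Sum>j=1..N. b j * cis (2 * pi * s j * y))"
  using assms
proof (induction rule: torus_trig_poly.induct)
  case (character k c)
  have "(\<Sum>i\<in>I. of_int (k i) * (r i * y)) = (\<Sum>i\<in>I. of_int (k i) * r i) * y" for y
    by (simp add: sum_distrib_right mult.assoc)
  then show ?case
    by (intro exI[of _ 1] exI[of _ "\<lambda>_. c"] exI[of _ "\<lambda>_. \<Sum>i\<in>I. of_int (k i) * r i"]) 
      (simp add: mult.assoc)
next
  case (add F G)
  from add.IH(1) obtain N b s where
    F: "\<And>y. F (\<lambda>i. r i * y) = (\<Sum>j=1..N::nat. b j * cis (2 * pi * s j * y))" by auto
  from add.IH(2) obtain M b' s' where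
    G: "\<And>y. G (\<lambda>i. r i * y) = (\<Sum>j=1..M::nat. b' j * cis (2 * pi * s' j * y))" by auto
  have "F (\<lambda>i. r i * y) + G (\<lambda>i. r i * y) =
     (\<Sum>j=1..N+M. (if j \<le> N then b j else b' (j - N)) * cis (2 * pi * (if j \<le> N then s j else s' (j - N)) * y))" for y
  proof -
    let ?f = "\<lambda>j. (if j \<le> N then b j else b' (j - N)) * cis (2 * pi * (if j \<le> N then s j else s' (j - N)) * y)"
    have "(\<Sum>j=1..N+M. ?f j) = (\<Sum>j=1..N. ?f j) + (\<Sum>j=N+1..N+M. ?f j)"
      by (rule sum.ub_add_nat) simp
    also have "(\<Sum>j=N+1..N+M. ?f j) = (\<Sum>j=1..M. ?f (j + N))"
      using sum.shift_bounds_cl_nat_ivl[of ?f 1 N M] by (simp add: add.commute)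
    finally show ?thesis by (simp add: F G)
  qed
  then show ?case
    by (intro exI[of _ "N + M"] exI[of _ "\<lambda>j. if j \<le> N then b j else b' (j - N)"]
        exI[of _ "\<lambda>j. if j \<le> N then s j else s' (j - N)"] allI)
qed

definition rationally_independent_on :: "nat set \<Rightarrow> (nat \<Rightarrow> real) \<Rightarrow> bool" where
  "rationally_independent_on I r \<longleftrightarrow>
     (\<forall>k::nat \<Rightarrow> int. (\<Sum>i\<in>I. of_int (k i) * r i) = 0 \<longrightarrow> (\<forall>i\<in>I. k i = 0))"

text \<open>
  Weyl's argument: independence of \<open>r\<close> means that a character is trivial along the line
  exactly if it is trivial on the torus.
\<close>

lemma mean_value_torus_trig_poly:
  assumes I: "finite I" and r: "rationally_independent_on I r" and F: "torus_trig_poly I F"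
  shows "((\<lambda>L. \<integral>y. F (\<lambda>i. r i * y) \<partial>mean_measure L) \<longlongrightarrow> (\<integral>t. F t \<partial>torus_measure I)) at_top"
  using F
proof (induction rule: torus_trig_poly.induct)
  case (character k c)
  define s where "s = 2 * pi * (\<Sum>i\<in>I. of_int (k i) * r i)"
  have eq: "2 * pi * (\<Sum>i\<in>I. of_int (k i) * (r i * y)) = s * y" for y
    by (simp add: s_def sum_distrib_right mult.assoc)
  have "s = 0 \<longleftrightarrow> (\<forall>i\<in>I. k i = 0)"
    using r by (auto simp: s_def rationally_independent_on_def)
  then have "((\<lambda>L. c * (\<integral>y. cis (s * y) \<partial>mean_measure L))
      \<longlongrightarrow> c * (\<integral>t. cis (2 * pi * (\<Sum>i\<in>I. of_int (k i) * t i)) \<partial>torus_measure I)) at_top"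
    using mean_value_cis[of s] by (intro tendsto_mult_left) (simp add: integral_torus_character[OF I])
  then show ?case by (simp add: eq)
next
  case (add F G)
  obtain B C where B: "\<And>t. cmod (F t) \<le> B" and C: "\<And>t. cmod (G t) \<le> C"
    using torus_trig_poly_bounded add.hyps by meson
  have "integrable (torus_measure I) F" "integrable (torus_measure I) G"
    by (rule integrable_prob_space_bounded[OF prob_space_torus_measure[OF I]
          torus_trig_poly_measurable], rule add.hyps, rule B C)+
  then have eq: "(\<integral>t. F t + G t \<partial>torus_measure I) = (\<integral>t. F t \<partial>torus_measure I) + (\<integral>t. G t \<partial>torus_measure I)"
    by simp
  have "\<forall>\<^sub>F L in at_top. (\<integral>y. F (\<lambda>i. r i * y) \<partial>mean_measure L) + (\<integral>y. G (\<lambda>i. r i * y) \<partial>mean_measure L)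
     = (\<integral>y. F (\<lambda>i. r i * y) + G (\<lambda>i. r i * y) \<partial>mean_measure L)"
    using eventually_gt_at_top[of 0]
  proof eventually_elim
    case (elim L)
    have "integrable (mean_measure L) (\<lambda>y. F (\<lambda>i. r i * y))" "integrable (mean_measure L) (\<lambda>y. G (\<lambda>i. r i * y))"
      by (rule integrable_prob_space_bounded[OF prob_space_mean_measure[OF elim]
            borel_measurable_mean_measure[OF torus_trig_poly_flow_measurable]], rule add.hyps, rule B C)+
    then show ?case by simp
  qed
  then show ?case unfolding eq by (rule Lim_transform_eventually[OF tendsto_add[OF add.IH]])
qed

lemma abs_integral_diff_le:
  fixes f g :: "'a \<Rightarrow> real"
  assumes "prob_space M" "integrable M f" "integrable M g" "\<And>x. \<bar>f x - g x\<bar> \<le> e"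
  shows "\<bar>(\<integral>x. f x \<partial>M) - (\<integral>x. g x \<partial>M)\<bar> \<le> e"
proof -
  interpret prob_space M by fact
  have "\<bar>(\<integral>x. f x \<partial>M) - (\<integral>x. g x \<partial>M)\<bar> \<le> (\<integral>x. \<bar>f x - g x\<bar> \<partial>M)"
    using assms integral_abs_bound[of M "\<lambda>x. f x - g x"] by simp
  also have "\<dots> \<le> (\<integral>x. e \<partial>M)" using assms by (intro integral_mono) auto
  finally show ?thesis by (simp add: prob_space)
qed

lemma equidistribution_norm_trig_poly:
  fixes \<phi> :: "real \<Rightarrow> real"
  assumes I: "finite I" and r: "rationally_independent_on I r" and F: "torus_trig_poly I F"
    and B: "\<And>t. (cmod (F t))\<^sup>2 \<le> B" and cont: "continuous_on {0..B} \<phi>"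
  shows "((\<lambda>L. \<integral>y. \<phi> ((cmod (F (\<lambda>i. r i * y)))\<^sup>2) \<partial>mean_measure L)
      \<longlongrightarrow> (\<integral>t. \<phi> ((cmod (F t))\<^sup>2) \<partial>torus_measure I)) at_top"
proof -
  note [measurable] = torus_trig_poly_measurable[OF F] torus_trig_poly_flow_measurable[OF F, of r]
  \<comment> \<open>The function \<open>\<phi>\<close> is arbitrary outside \<open>{0..B}\<close>; extending it by its boundary values
    makes it measurable without changing the integrands.\<close>
  define \<psi> where "\<psi> x = \<phi> (max 0 (min B x))" for x
  have B0: "0 \<le> B" using B[of undefined] by (rule order_trans[OF zero_le_power2])
  have \<psi>eq: "\<phi> ((cmod (F t))\<^sup>2) = \<psi> ((cmod (F t))\<^sup>2)" for t using B by (simp add: \<psi>_def)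
  have \<psi>cont: "continuous_on UNIV \<psi>"
    unfolding \<psi>_def using B0
    by (intro continuous_on_compose2[OF cont] continuous_intros) auto
  then have [measurable]: "\<psi> \<in> borel_measurable borel" by (rule borel_measurable_continuous_onI)
  have ev: "\<forall>\<^sub>F L in at_top. (0::real) < L" by (rule eventually_gt_at_top)
  have bounded: "\<exists>C. \<forall>t. \<bar>q ((cmod (F t))\<^sup>2)\<bar> \<le> C" if "continuous_on {0..B} q" for q :: "real \<Rightarrow> real"
  proof -
    have "bounded (q ` {0..B})" using that by (intro compact_imp_bounded compact_continuous_image) auto
    then obtain C where "\<And>x. x \<in> {0..B} \<Longrightarrow> \<bar>q x\<bar> \<le> C" by (force simp: bounded_iff)
    then show ?thesis using B by (intro exI[of _ C]) simp
  qed
  show ?thesis unfolding \<psi>eq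
  proof (rule tendstoI)
    fix e :: real assume e: "0 < e"
    obtain q where q: "real_polynomial_function q" and qe: "\<And>x. x \<in> {0..B} \<Longrightarrow> \<bar>\<psi> x - q x\<bar> < e / 3"
      using Stone_Weierstrass_real_polynomial_function[of "{0..B}" \<psi> "e / 3"] e
        continuous_on_subset[OF \<psi>cont] by auto
    have qcont: "continuous_on S q" for S
      using q by (intro continuous_on_polymonial_function) (simp add: real_polynomial_function_eq)
    then have [measurable]: "q \<in> borel_measurable borel" by (intro borel_measurable_continuous_onI)
    obtain C D where C: "\<And>t. \<bar>q ((cmod (F t))\<^sup>2)\<bar> \<le> C" and D: "\<And>t. \<bar>\<psi> ((cmod (F t))\<^sup>2)\<bar> \<le> D"
      using bounded[OF qcont] bounded[OF continuous_on_subset[OF \<psi>cont]] by auto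
    have diff: "\<bar>\<psi> ((cmod (F t))\<^sup>2) - q ((cmod (F t))\<^sup>2)\<bar> \<le> e / 3" for t
      using qe[of "(cmod (F t))\<^sup>2"] B by (simp add: less_imp_le)
    have dT: "\<bar>(\<integral>t. \<psi> ((cmod (F t))\<^sup>2) \<partial>torus_measure I) - (\<integral>t. q ((cmod (F t))\<^sup>2) \<partial>torus_measure I)\<bar> \<le> e / 3"
      using C D diff prob_space_torus_measure[OF I]
      by (intro abs_integral_diff_le integrable_prob_space_bounded) auto
    have "((\<lambda>L. \<integral>y. complex_of_real (q ((cmod (F (\<lambda>i. r i * y)))\<^sup>2)) \<partial>mean_measure L)
        \<longlongrightarrow> (\<integral>t. complex_of_real (q ((cmod (F t))\<^sup>2)) \<partial>torus_measure I)) at_top"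
      by (intro mean_value_torus_trig_poly[OF I r] torus_trig_poly_polynomial_norm F q)
    then have "((\<lambda>L. \<integral>y. q ((cmod (F (\<lambda>i. r i * y)))\<^sup>2) \<partial>mean_measure L)
        \<longlongrightarrow> (\<integral>t. q ((cmod (F t))\<^sup>2) \<partial>torus_measure I)) at_top"
      by (simp add: tendsto_of_real_iff)
    then have "\<forall>\<^sub>F L in at_top. dist (\<integral>y. q ((cmod (F (\<lambda>i. r i * y)))\<^sup>2) \<partial>mean_measure L)
        (\<integral>t. q ((cmod (F t))\<^sup>2) \<partial>torus_measure I) < e / 3"
      using e by (intro tendstoD) auto
    then show "\<forall>\<^sub>F L in at_top. dist (\<integral>y. \<psi> ((cmod (F (\<lambda>i. r i * y)))\<^sup>2) \<partial>mean_measure L)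
        (\<integral>t. \<psi> ((cmod (F t))\<^sup>2) \<partial>torus_measure I) < e"
      using ev
    proof eventually_elim
      case (elim L)
      have "\<bar>(\<integral>y. \<psi> ((cmod (F (\<lambda>i. r i * y)))\<^sup>2) \<partial>mean_measure L)
          - (\<integral>y. q ((cmod (F (\<lambda>i. r i * y)))\<^sup>2) \<partial>mean_measure L)\<bar> \<le> e / 3"
        using C D diff prob_space_mean_measure[OF elim(2)]
        by (intro abs_integral_diff_le integrable_prob_space_bounded borel_measurable_mean_measure) auto
      with elim(1) dT show ?case unfolding dist_real_def by linarith
    qed
  qed
qed

section \<open>Regularized logarithms\<close>

text \<open>
  Where \<open>w x\<close> lies between \<open>2 ^ n\<close> and \<open>2 ^ Suc n\<close>, it is at most the \<open>n\<close>-th term of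
  \<open>\<Sum>n. 2 ^ Suc n * indicator {x. 2 ^ n \<le> w x} x\<close>, whose integral is bounded by a geometric
  series of ratio one half.
\<close>

lemma nn_integral_le_of_dyadic_tails:
  fixes w :: "'a \<Rightarrow> real"
  assumes "prob_space M" and [measurable]: "w \<in> borel_measurable M" and "0 \<le> C"
    and tail: "\<And>n. measure M {x\<in>space M. 2 ^ n \<le> w x} \<le> C * (1 / 4) ^ n"
  shows "(\<integral>\<^sup>+x. ennreal (w x) \<partial>M) \<le> ennreal (1 + 4 * C)"
proof -
  interpret prob_space M by fact
  let ?E = "\<lambda>n. {x\<in>space M. 2 ^ n \<le> w x}"
  have "ennreal (w x) \<le> 1 + suminf (\<lambda>n. ennreal (2 ^ Suc n) * indicator (?E n) x)" if x: "x \<in> space M" for x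
  proof (cases "w x < 1")
    case True
    then have "ennreal (w x) \<le> 1" by (simp add: ennreal_le_1)
    then show ?thesis by (rule order_trans) (rule order_trans[OF _ add_mono[OF order_refl zero_le]], simp)
  next
    case False
    define N where "N = (LEAST N. w x < 2 ^ N)"
    have N: "w x < 2 ^ N" unfolding N_def using real_arch_pow[of 2 "w x"] by (auto intro: LeastI)
    with False obtain n where n: "N = Suc n" by (cases N) auto
    have "\<not> w x < 2 ^ n" using not_less_Least[of n "\<lambda>N. w x < 2 ^ N"] n by (simp add: N_def)
    then have "ennreal (w x) \<le> ennreal (2 ^ Suc n) * indicator (?E n) x"
      using N n x by (simp add: indicator_def ennreal_leI del: power_Suc)
    also have "\<dots> \<le> suminf (\<lambda>n. ennreal (2 ^ Suc n) * indicator (?E n) x)"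
      using sum_le_suminf[of "\<lambda>n. ennreal (2 ^ Suc n) * indicator (?E n) x" "{n}"]
      by (simp only: sum.insert sum.empty finite.intros empty_iff simp_thms add_0_right zero_le
          summableI)
    also have "\<dots> \<le> 1 + \<dots>" by simp
    finally show ?thesis .
  qed
  then have "(\<integral>\<^sup>+x. ennreal (w x) \<partial>M) \<le> (\<integral>\<^sup>+x. 1 + (suminf (\<lambda>n. ennreal (2 ^ Suc n) * indicator (?E n) x)) \<partial>M)"
    by (intro nn_integral_mono) auto
  also have "\<dots> = 1 + suminf (\<lambda>n. ennreal (2 ^ Suc n) * emeasure M (?E n))"
    by (subst nn_integral_add) (simp_all add: nn_integral_suminf nn_integral_cmult emeasure_space_1)
  also have "\<dots> \<le> 1 + suminf (\<lambda>n. ennreal (2 * C * (1 / 2) ^ n))"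
  proof (intro add_left_mono suminf_le allI)
    fix n
    have "ennreal (2 ^ Suc n) * emeasure M (?E n) = ennreal (2 ^ Suc n * measure M (?E n))"
      by (simp add: emeasure_eq_measure ennreal_mult'')
    also have "\<dots> \<le> ennreal (2 ^ Suc n * (C * (1 / 4) ^ n))"
      by (intro ennreal_leI mult_left_mono tail) auto
    also have "2 ^ Suc n * (C * (1 / 4) ^ n) = 2 * C * (1 / 2) ^ n"
    proof -
      have "(2::real) ^ n * (1 / 4) ^ n = (1 / 2) ^ n" by (simp flip: power_mult_distrib)
      then show ?thesis by (simp add: ac_simps)
    qed
    finally show "ennreal (2 ^ Suc n) * emeasure M (?E n) \<le> ennreal (2 * C * (1 / 2) ^ n)" .
  qed auto
  also have "suminf (\<lambda>n. ennreal (2 * C * (1 / 2) ^ n)) = ennreal (4 * C)"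
    using \<open>0 \<le> C\<close> sums_mult[OF geometric_sums[of "1 / 2 :: real"], of "2 * C"]
    by (intro suminf_ennreal_eq) auto
  also have "1 + ennreal (4 * C) = ennreal (1 + 4 * C)" using \<open>0 \<le> C\<close> by (simp add: ennreal_plus)
  finally show ?thesis .
qed

lemma tendsto_powr_at_right_0:
  fixes s :: real
  assumes "0 < s"
  shows "((\<lambda>x. x powr s) \<longlongrightarrow> 0) (at_right 0)"
  using tendsto_powr'[of "\<lambda>x::real. x" 0 "at_right 0" "\<lambda>_. s" s] assms
  by (auto simp: eventually_at_right_less eventually_at_filter)

text \<open>
  With \<open>v = u powr p\<close> and \<open>q = 1 / p\<close> this follows from \<open>1 + v powr q \<le> (1 + v) powr q\<close>
  and \<open>ln (1 + v) \<le> v\<close>.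
\<close>

lemma ln_one_plus_le_powr:
  fixes u p :: real
  assumes "0 < u" "0 < p" "p \<le> 1"
  shows "ln (1 + u) \<le> u powr p / p"
proof -
  define v q where "v = u powr p" and "q = 1 / p"
  have v: "0 < v" and q: "1 \<le> q" using assms by (auto simp: v_def q_def)
  have "u = v * v powr (q - 1)"
    using assms v by (simp add: v_def q_def powr_powr flip: powr_add) (simp add: field_simps flip: powr_add)
  then have "1 + u \<le> (1 + v) powr (q - 1) + v * (1 + v) powr (q - 1)"
    using v q by (intro add_mono mult_left_mono ge_one_powr_ge_zero) 
      (auto intro!: mult_left_mono powr_mono2)
  also have "\<dots> = (1 + v) * (1 + v) powr (q - 1)" by (simp add: algebra_simps)
  also have "\<dots> = (1 + v) powr q" using v powr_add[of "1 + v" 1 "q - 1"] by simp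
  finally have "ln (1 + u) \<le> ln ((1 + v) powr q)"
    using assms v by (subst ln_le_cancel_iff) auto
  also have "\<dots> = q * ln (1 + v)" using v by (simp add: ln_powr)
  also have "\<dots> \<le> q * v" using v q by (intro mult_left_mono ln_add_one_self_le_self) auto
  finally show ?thesis by (simp add: v_def q_def)
qed

text \<open>
  The error is \<open>ln (1 + \<epsilon> / z)\<close>, which is at most a multiple of \<open>(\<epsilon> / z) powr (s / 2)\<close>. The
  exponent is chosen so that the square of this bound costs no more than the power \<open>-s\<close> of \<open>z\<close>.
\<close>

lemma ln_regularization_error:
  fixes z \<epsilon> s :: real
  assumes "0 < z" "0 < \<epsilon>" "\<epsilon> \<le> 1" "0 < s" "s \<le> 1"
  shows "\<bar>ln z - ln (z + \<epsilon>)\<bar> \<le> 4 / s\<^sup>2 * \<epsilon> powr (s / 2) * (1 + z powr - s)" (is ?A)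
    and "(ln z - ln (z + \<epsilon>))\<^sup>2 \<le> 4 / s\<^sup>2 * \<epsilon> powr (s / 2) * (1 + z powr - s)" (is ?B)
proof -
  define D where "D = ln (z + \<epsilon>) - ln z"
  define e t where "e = \<epsilon> powr (s / 2)" and "t = z powr (- s / 2)"
  have e: "0 < e" "e \<le> 1" and t: "0 < t" using assms by (auto simp: e_def t_def powr_le1)
  have t2: "t * t = z powr - s" by (simp add: t_def flip: powr_add)
  have D0: "0 \<le> D" using assms by (simp add: D_def)
  have "D = ln (1 + \<epsilon> / z)" using assms ln_div[of "z + \<epsilon>" z] by (simp add: D_def add_divide_distrib)
  also have "\<dots> \<le> (\<epsilon> / z) powr (s / 2) / (s / 2)" using assms by (intro ln_one_plus_le_powr) auto
  also have "\<dots> = 2 / s * (e * t)"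
    using assms by (simp add: e_def t_def powr_divide powr_minus_divide mult.commute)
  finally have D: "D \<le> 2 / s * (e * t)" .
  have t1: "t \<le> 1 + t * t" 
  proof (cases "t \<le> 1")
    case False then show ?thesis using mult_left_mono[of 1 t t] by linarith
  qed (use t in \<open>simp add: add.commute add_nonneg_nonneg order_trans[of t 1]\<close>)
  have s: "2 / s \<le> 4 / s\<^sup>2" "0 < 2 / s" using assms by (auto simp: field_simps power2_eq_square)
  have "2 / s * (e * t) \<le> 4 / s\<^sup>2 * (e * (1 + t * t))"
    using s e t t1 by (intro mult_mono) auto
  with D D0 show ?A by (simp add: D_def e_def t2 mult.assoc)
  have "D\<^sup>2 \<le> (2 / s * (e * t))\<^sup>2" using D D0 by (rule power_mono)
  also have "\<dots> = 4 / s\<^sup>2 * (e * e * (t * t))" by (simp add: power2_eq_square)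
  also have "\<dots> \<le> 4 / s\<^sup>2 * (e * (1 + t * t))"
    using e t by (intro mult_left_mono mult_mono) (auto simp: mult_le_one intro: mult_left_le)
  finally show ?B by (simp add: D_def e_def t2 mult.assoc power2_commute)
qed

text \<open>
  The bound for positive \<open>\<epsilon>\<close> passes to the limit by Fatou's lemma. As \<open>0 powr - s = 0\<close>, the
  zeros of \<open>Z\<close> are treated separately: on them the regularized integrand
  is \<open>\<epsilon> powr - s\<close>, which is unbounded, so they form a null set.
\<close>

lemma nn_integral_powr_minus_le_of_regularized:
  fixes Z :: "'a \<Rightarrow> real"
  assumes "prob_space M" and [measurable]: "Z \<in> borel_measurable M"
    and nonneg: "\<And>x. x \<in> space M \<Longrightarrow> 0 \<le> Z x" and s: "0 < s" and C: "0 \<le> C"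
    and mom: "\<And>\<epsilon>. 0 < \<epsilon> \<Longrightarrow> (\<integral>\<^sup>+x. ennreal ((Z x + \<epsilon>) powr - s) \<partial>M) \<le> ennreal C"
  shows "AE x in M. 0 < Z x" "(\<integral>\<^sup>+x. ennreal (Z x powr - s) \<partial>M) \<le> ennreal C"
proof -
  interpret prob_space M by fact
  let ?N = "{x\<in>space M. Z x = 0}"
  have bound: "measure M ?N \<le> C * \<epsilon> powr s" if "0 < \<epsilon>" for \<epsilon>
  proof -
    have "ennreal (\<epsilon> powr - s * measure M ?N) = (\<integral>\<^sup>+x. ennreal (\<epsilon> powr - s) * indicator ?N x \<partial>M)"
      by (subst nn_integral_cmult_indicator) (auto simp: emeasure_eq_measure ennreal_mult'')
    also have "\<dots> \<le> (\<integral>\<^sup>+x. ennreal ((Z x + \<epsilon>) powr - s) \<partial>M)"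
      by (intro nn_integral_mono) (auto simp: indicator_def)
    also have "\<dots> \<le> ennreal C" using mom that .
    finally have "\<epsilon> powr - s * measure M ?N \<le> C" using C by simp
    then show ?thesis using that by (simp add: powr_minus field_simps)
  qed
  have "((\<lambda>\<epsilon>. C * \<epsilon> powr s) \<longlongrightarrow> C * 0) (at_right 0)"
    using s by (intro tendsto_intros tendsto_powr_at_right_0) auto
  then have "measure M ?N \<le> C * 0"
    by (rule tendsto_lowerbound) (auto intro!: bound eventually_at_right_less[THEN eventually_mono])
  then have "emeasure M ?N = 0" by (simp add: emeasure_eq_measure measure_le_0_iff)
  then have "AE x in M. Z x \<noteq> 0" by (intro AE_I[where N = ?N]) auto
  then show AE: "AE x in M. 0 < Z x"
    using AE_space by eventually_elim (use nonneg in \<open>force simp: less_le\<close>)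
  let ?w = "\<lambda>n x. ennreal ((Z x + 1 / real (Suc n)) powr - s)"
  have lim: "AE x in M. ennreal (Z x powr - s) = liminf (\<lambda>n. ?w n x)"
    using AE
  proof eventually_elim
    case (elim x)
    have "(\<lambda>n. Z x + 1 / real (Suc n)) \<longlonglongrightarrow> Z x + 0"
      by (intro tendsto_intros LIMSEQ_Suc lim_1_over_n)
    then have "(\<lambda>n. ?w n x) \<longlonglongrightarrow> ennreal (Z x powr - s)"
      using elim by (intro tendsto_intros tendsto_ennrealI) auto
    then show ?case by (rule lim_imp_Liminf[OF sequentially_bot, symmetric])
  qed
  have "(\<integral>\<^sup>+x. ennreal (Z x powr - s) \<partial>M) = (\<integral>\<^sup>+x. liminf (\<lambda>n. ?w n x) \<partial>M)"
    by (intro nn_integral_cong_AE lim)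
  also have "\<dots> \<le> liminf (\<lambda>n. \<integral>\<^sup>+x. ?w n x \<partial>M)"
    by (intro nn_integral_liminf) auto
  also have "\<dots> \<le> ennreal C"
    by (intro Liminf_le always_eventually allI mom) simp_all
  finally show "(\<integral>\<^sup>+x. ennreal (Z x powr - s) \<partial>M) \<le> ennreal C" .
qed

lemma regularized_ln_moments:
  fixes Z :: "'a \<Rightarrow> real"
  assumes M: "prob_space M" and Z [measurable]: "Z \<in> borel_measurable M"
    and nonneg: "\<And>x. x \<in> space M \<Longrightarrow> 0 \<le> Z x" and s: "0 < s" "s \<le> 1" and C: "0 \<le> C"
    and mom: "\<And>\<epsilon>. 0 < \<epsilon> \<Longrightarrow> (\<integral>\<^sup>+x. ennreal ((Z x + \<epsilon>) powr - s) \<partial>M) \<le> ennreal C"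
    and \<epsilon>: "0 < \<epsilon>" "\<epsilon> \<le> 1"
  shows "(\<integral>\<^sup>+x. ennreal \<bar>ln (Z x) - ln (Z x + \<epsilon>)\<bar> \<partial>M) \<le> ennreal (4 / s\<^sup>2 * \<epsilon> powr (s / 2) * (1 + C))"
    and "(\<integral>\<^sup>+x. ennreal ((ln (Z x) - ln (Z x + \<epsilon>))\<^sup>2) \<partial>M) \<le> ennreal (4 / s\<^sup>2 * \<epsilon> powr (s / 2) * (1 + C))"
proof -
  interpret prob_space M by fact
  have neg: "AE x in M. 0 < Z x" "(\<integral>\<^sup>+x. ennreal (Z x powr - s) \<partial>M) \<le> ennreal C"
    by (rule nn_integral_powr_minus_le_of_regularized[OF M Z nonneg s(1) C mom]; assumption)+
  let ?c = "4 / s\<^sup>2 * \<epsilon> powr (s / 2)"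
  have c: "0 \<le> ?c" by simp
  have *: "(\<integral>\<^sup>+x. ennreal (f x) \<partial>M) \<le> ennreal (?c * (1 + C))"
    if f: "\<And>x. 0 < Z x \<Longrightarrow> f x \<le> ?c * (1 + Z x powr - s)" for f :: "'a \<Rightarrow> real"
  proof -
    have "(\<integral>\<^sup>+x. ennreal (f x) \<partial>M) \<le> (\<integral>\<^sup>+x. ennreal ?c * (1 + ennreal (Z x powr - s)) \<partial>M)"
    proof (intro nn_integral_mono_AE, use neg(1) in eventually_elim)
      case (elim x)
      have "ennreal (f x) \<le> ennreal (?c * (1 + Z x powr - s))" using f[OF elim] by (rule ennreal_leI)
      also have "\<dots> = ennreal ?c * (1 + ennreal (Z x powr - s))"
        by (subst ennreal_mult) (auto simp: ennreal_plus)
      finally show ?case .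
    qed
    also have "\<dots> = ennreal ?c * (1 + (\<integral>\<^sup>+x. ennreal (Z x powr - s) \<partial>M))"
      by (simp add: nn_integral_cmult nn_integral_add emeasure_space_1)
    also have "\<dots> \<le> ennreal ?c * (1 + ennreal C)"
      by (intro mult_left_mono add_left_mono neg) auto
    also have "\<dots> = ennreal (?c * (1 + C))"
      using C by (subst ennreal_mult) (auto simp: ennreal_plus)
    finally show ?thesis .
  qed
  show "(\<integral>\<^sup>+x. ennreal \<bar>ln (Z x) - ln (Z x + \<epsilon>)\<bar> \<partial>M) \<le> ennreal (?c * (1 + C))"
    by (intro * ln_regularization_error \<epsilon> s)
  show "(\<integral>\<^sup>+x. ennreal ((ln (Z x) - ln (Z x + \<epsilon>))\<^sup>2) \<partial>M) \<le> ennreal (?c * (1 + C))"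
    by (intro * ln_regularization_error \<epsilon> s)
qed

lemma integral_ln_regularization:
  fixes Z :: "'a \<Rightarrow> real"
  assumes M: "prob_space M" and Z [measurable]: "Z \<in> borel_measurable M"
    and nonneg: "\<And>x. x \<in> space M \<Longrightarrow> 0 \<le> Z x" and bdd: "\<And>x. x \<in> space M \<Longrightarrow> Z x \<le> B"
    and s: "0 < s" "s \<le> 1" and C: "0 \<le> C"
    and mom: "\<And>\<epsilon>. 0 < \<epsilon> \<Longrightarrow> (\<integral>\<^sup>+x. ennreal ((Z x + \<epsilon>) powr - s) \<partial>M) \<le> ennreal C"
    and \<epsilon>: "0 < \<epsilon>" "\<epsilon> \<le> 1"
  shows "\<bar>(\<integral>x. ln (Z x) \<partial>M) - (\<integral>x. ln (Z x + \<epsilon>) \<partial>M)\<bar> \<le> 4 / s\<^sup>2 * \<epsilon> powr (s / 2) * (1 + C)"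
proof -
  interpret prob_space M by fact
  have m: "(\<integral>\<^sup>+x. ennreal \<bar>ln (Z x) - ln (Z x + \<epsilon>)\<bar> \<partial>M)
      \<le> ennreal (4 / s\<^sup>2 * \<epsilon> powr (s / 2) * (1 + C))"
    by (rule regularized_ln_moments(1)[OF M Z nonneg s C mom \<epsilon>])
  have i1: "integrable M (\<lambda>x. ln (Z x) - ln (Z x + \<epsilon>))"
    using m by (intro integrableI_bounded) (auto simp: top_unique less_top[symmetric])
  have i2: "integrable M (\<lambda>x. ln (Z x + \<epsilon>))"
  proof (rule integrable_const_bound[where B = "\<bar>ln \<epsilon>\<bar> + \<bar>ln (B + \<epsilon>)\<bar>"])
    show "AE x in M. norm (ln (Z x + \<epsilon>)) \<le> \<bar>ln \<epsilon>\<bar> + \<bar>ln (B + \<epsilon>)\<bar>"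
    proof (rule AE_I2)
      fix x assume x: "x \<in> space M"
      have "ln \<epsilon> \<le> ln (Z x + \<epsilon>)" "ln (Z x + \<epsilon>) \<le> ln (B + \<epsilon>)"
        using nonneg[OF x] bdd[OF x] \<epsilon> by auto
      then show "norm (ln (Z x + \<epsilon>)) \<le> \<bar>ln \<epsilon>\<bar> + \<bar>ln (B + \<epsilon>)\<bar>" by simp
    qed
  qed simp
  have i3: "integrable M (\<lambda>x. ln (Z x))"
    using Bochner_Integration.integrable_add[OF i1 i2] by simp
  have "\<bar>(\<integral>x. ln (Z x) \<partial>M) - (\<integral>x. ln (Z x + \<epsilon>) \<partial>M)\<bar> = \<bar>\<integral>x. ln (Z x) - ln (Z x + \<epsilon>) \<partial>M\<bar>"
    using i2 i3 by simp
  also have "\<dots> \<le> (\<integral>x. \<bar>ln (Z x) - ln (Z x + \<epsilon>)\<bar> \<partial>M)" by (rule integral_abs_bound)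
  also have "\<dots> = enn2real (\<integral>\<^sup>+x. ennreal \<bar>ln (Z x) - ln (Z x + \<epsilon>)\<bar> \<partial>M)"
    using i1 by (intro integral_eq_nn_integral) auto
  also have "\<dots> \<le> 4 / s\<^sup>2 * \<epsilon> powr (s / 2) * (1 + C)"
    using m C by (intro enn2real_leI) auto
  finally show ?thesis .
qed

text \<open>
  Convergence in distribution of bounded nonnegative variables gives convergence of the mean
  logarithms, provided that a negative moment stays bounded. The moment bound is required for the
  approximating variables only: the limit inherits it, because \<open>(z + \<epsilon>) powr - s\<close> is continuous.
\<close>

lemma tendsto_integral_ln:
  fixes Z :: "'a \<Rightarrow> real" and W :: "'b \<Rightarrow> real" and M :: "real \<Rightarrow> 'a measure"
  assumes M: "\<And>L. 1 \<le> L \<Longrightarrow> prob_space (M L)" and N: "prob_space N"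
    and Z: "\<And>L. 1 \<le> L \<Longrightarrow> Z \<in> borel_measurable (M L)" and W [measurable]: "W \<in> borel_measurable N"
    and Zb: "\<And>x. 0 \<le> Z x" "\<And>x. Z x \<le> B" and Wb: "\<And>x. 0 \<le> W x" "\<And>x. W x \<le> B"
    and s: "0 < s" "s \<le> 1" and C: "0 \<le> C"
    and mom: "\<And>L \<epsilon>. 1 \<le> L \<Longrightarrow> 0 < \<epsilon> \<Longrightarrow> (\<integral>\<^sup>+x. ennreal ((Z x + \<epsilon>) powr - s) \<partial>M L) \<le> ennreal C"
    and lim: "\<And>\<phi>::real \<Rightarrow> real. continuous_on {0..B} \<phi> \<Longrightarrow>
      ((\<lambda>L. \<integral>x. \<phi> (Z x) \<partial>M L) \<longlongrightarrow> (\<integral>x. \<phi> (W x) \<partial>N)) at_top"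
  shows "((\<lambda>L. \<integral>x. ln (Z x) \<partial>M L) \<longlongrightarrow> (\<integral>x. ln (W x) \<partial>N)) at_top"
proof -
  interpret N: prob_space N by fact
  have ev: "\<forall>\<^sub>F L in at_top. (1::real) \<le> L" by (rule eventually_ge_at_top)
  have pb: "norm ((x + \<epsilon>) powr - s) \<le> \<epsilon> powr - s" if "0 < \<epsilon>" "0 \<le> x" for x \<epsilon> :: real
    using that s by (auto intro!: powr_mono2')
  have momW: "(\<integral>\<^sup>+x. ennreal ((W x + \<epsilon>) powr - s) \<partial>N) \<le> ennreal C" if \<epsilon>: "0 < \<epsilon>" for \<epsilon>
  proof -
    have "(\<integral>x. (Z x + \<epsilon>) powr - s \<partial>M L) \<le> C" if L: "1 \<le> L" for L
    proof -
      interpret prob_space "M L" using M L .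
      note [measurable] = Z[OF L]
      have "(\<integral>x. (Z x + \<epsilon>) powr - s \<partial>M L) = enn2real (\<integral>\<^sup>+x. ennreal ((Z x + \<epsilon>) powr - s) \<partial>M L)"
        by (intro integral_eq_nn_integral) auto
      also have "\<dots> \<le> C" using mom[OF L \<epsilon>] C by (intro enn2real_leI)
      finally show ?thesis .
    qed
    moreover have "((\<lambda>L. \<integral>x. (Z x + \<epsilon>) powr - s \<partial>M L) \<longlongrightarrow> (\<integral>x. (W x + \<epsilon>) powr - s \<partial>N)) at_top"
      using \<epsilon> by (intro lim continuous_intros) auto
    ultimately have le: "(\<integral>x. (W x + \<epsilon>) powr - s \<partial>N) \<le> C"
      using ev by (intro tendsto_upperbound[where F = at_top]) (auto intro: eventually_mono[OF ev])
    have "integrable N (\<lambda>x. (W x + \<epsilon>) powr - s)"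
      using pb[OF \<epsilon>] Wb by (intro N.integrable_const_bound[where B = "\<epsilon> powr - s"]) auto
    then have "(\<integral>\<^sup>+x. ennreal ((W x + \<epsilon>) powr - s) \<partial>N) = ennreal (\<integral>x. (W x + \<epsilon>) powr - s \<partial>N)"
      by (intro nn_integral_eq_integral) auto
    with le show ?thesis by (simp add: ennreal_leI)
  qed
  show ?thesis
  proof (rule tendstoI)
    fix e :: real assume e: "0 < e"
    have "((\<lambda>\<epsilon>. 4 / s\<^sup>2 * \<epsilon> powr (s / 2) * (1 + C)) \<longlongrightarrow> 4 / s\<^sup>2 * 0 * (1 + C)) (at_right 0)"
      using s by (intro tendsto_intros tendsto_powr_at_right_0) auto
    then have "\<forall>\<^sub>F \<epsilon> in at_right 0. 4 / s\<^sup>2 * \<epsilon> powr (s / 2) * (1 + C) < e / 3"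
      by (rule order_tendstoD) (use e in auto)
    moreover have "\<forall>\<^sub>F \<epsilon> in at_right 0. \<epsilon> \<in> {0<..<1::real}"
      by (rule eventually_at_right_real) simp
    ultimately have "\<forall>\<^sub>F \<epsilon> in at_right 0. \<epsilon> \<in> {0<..<1} \<and> 4 / s\<^sup>2 * \<epsilon> powr (s / 2) * (1 + C) < e / 3"
      by eventually_elim auto
    then obtain \<epsilon> where \<epsilon>: "0 < \<epsilon>" "\<epsilon> \<le> 1" "4 / s\<^sup>2 * \<epsilon> powr (s / 2) * (1 + C) < e / 3"
      using eventually_happens'[of "at_right (0::real)"] by force
    have dW: "\<bar>(\<integral>x. ln (W x) \<partial>N) - (\<integral>x. ln (W x + \<epsilon>) \<partial>N)\<bar> < e / 3"
      by (rule le_less_trans[OF integral_ln_regularization[OF N W Wb s C momW \<epsilon>(1,2)] \<epsilon>(3)])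
    have "((\<lambda>L. \<integral>x. ln (Z x + \<epsilon>) \<partial>M L) \<longlongrightarrow> (\<integral>x. ln (W x + \<epsilon>) \<partial>N)) at_top"
      using \<epsilon> by (intro lim continuous_intros) auto
    then have "\<forall>\<^sub>F L in at_top. dist (\<integral>x. ln (Z x + \<epsilon>) \<partial>M L) (\<integral>x. ln (W x + \<epsilon>) \<partial>N) < e / 3"
      using e by (intro tendstoD) auto
    then show "\<forall>\<^sub>F L in at_top. dist (\<integral>x. ln (Z x) \<partial>M L) (\<integral>x. ln (W x) \<partial>N) < e"
      using ev
    proof eventually_elim
      case (elim L)
      have "\<bar>(\<integral>x. ln (Z x) \<partial>M L) - (\<integral>x. ln (Z x + \<epsilon>) \<partial>M L)\<bar> < e / 3"
        by (rule le_less_trans[OF integral_ln_regularization[OF M[OF elim(2)] Z[OF elim(2)]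
              Zb s C mom[OF elim(2)] \<epsilon>(1,2)] \<epsilon>(3)])
      with elim(1) dW show ?case unfolding dist_real_def by linarith
    qed
  qed
qed

section \<open>Laurent polynomials and the frequencies of the flow\<close>

lemma cis_sum: "cis (\<Sum>i\<in>I. f i) = (\<Prod>i\<in>I. cis (f i))"
  by (induction I rule: infinite_finite_induct) (auto simp: cis_mult[symmetric])

lemma laurent_eval_cis:
  assumes "laurent_vars P \<subseteq> I" "finite I"
  shows "laurent_eval P (\<lambda>i. cis (2 * pi * t i)) = (\<Sum>k\<in>Poly_Mapping.keys P. Poly_Mapping.lookup P k *
     cis (2 * pi * (\<Sum>i\<in>I. of_int (Poly_Mapping.lookup k i) * t i)))"
  unfolding laurent_eval_def
proof (intro sum.cong refl arg_cong2[where f = "(*)"])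
  fix k assume "k \<in> Poly_Mapping.keys P"
  then have k: "Poly_Mapping.keys k \<subseteq> I" using assms by (auto simp: laurent_vars_def)
  have "(\<Prod>i\<in>Poly_Mapping.keys k. cis (2 * pi * t i) powi Poly_Mapping.lookup k i)
      = (\<Prod>i\<in>I. cis (2 * pi * t i) powi Poly_Mapping.lookup k i)"
    using k assms by (intro prod.mono_neutral_left) (auto simp: in_keys_iff)
  also have "\<dots> = (\<Prod>i\<in>I. cis (2 * pi * (of_int (Poly_Mapping.lookup k i) * t i)))"
    by (intro prod.cong refl) (simp add: cis_power_int ac_simps)
  finally show "(\<Prod>i\<in>Poly_Mapping.keys k. cis (2 * pi * t i) powi Poly_Mapping.lookup k i)
      = cis (2 * pi * (\<Sum>i\<in>I. of_int (Poly_Mapping.lookup k i) * t i))"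
    by (simp add: sum_distrib_left cis_sum)
qed

lemma torus_trig_poly_laurent_eval:
  assumes "laurent_vars P \<subseteq> I" "finite I"
  shows "torus_trig_poly I (\<lambda>t. laurent_eval P (\<lambda>i. cis (2 * pi * t i)))"
  unfolding laurent_eval_cis[OF assms]
  by (intro torus_trig_poly_sum torus_trig_poly.character)

text \<open>
  The coefficient at frequency \<open>\<sigma> j\<close> is the mean value of the sum multiplied by
  \<open>cis (- \<sigma> j * y)\<close>. The frequencies \<open>\<rho>\<close> may coincide, so on the other side this mean value is a
  sum of coefficients, which is empty if no \<open>\<rho> k\<close> equals \<open>\<sigma> j\<close>.
\<close>

lemma exp_sum_frequency_determined:
  assumes "finite J" "inj_on \<sigma> J" "finite K"
    and eq: "\<And>y. exp_sum J a \<sigma> y = exp_sum K c \<rho> y" and j: "j \<in> J" "a j \<noteq> 0"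
  shows "\<exists>k\<in>K. \<rho> k = \<sigma> j"
proof (rule ccontr)
  assume none: "\<not> ?thesis"
  have shift: "exp_sum S b f y * cis (- \<sigma> j * y) = (\<Sum>i\<in>S. b i * cis ((f i - \<sigma> j) * y))"
    for S b y and f :: "'x \<Rightarrow> real"
    unfolding exp_sum_def sum_distrib_right
    by (intro sum.cong refl) (simp add: mult.assoc cis_mult left_diff_distrib)
  have "(\<Sum>i\<in>J. a i * cis ((\<sigma> i - \<sigma> j) * y)) = (\<Sum>i\<in>K. c i * cis ((\<rho> i - \<sigma> j) * y))" for y
    using eq by (simp flip: shift)
  then have "((\<lambda>L. \<integral>y. (\<Sum>i\<in>J. a i * cis ((\<sigma> i - \<sigma> j) * y)) \<partial>mean_measure L)
      \<longlongrightarrow> (\<Sum>i\<in>K. if \<rho> i - \<sigma> j = 0 then c i else 0)) at_top"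
    using mean_value_exp_sum[OF assms(3), of c "\<lambda>i. \<rho> i - \<sigma> j"] by simp
  moreover have "((\<lambda>L. \<integral>y. (\<Sum>i\<in>J. a i * cis ((\<sigma> i - \<sigma> j) * y)) \<partial>mean_measure L)
      \<longlongrightarrow> (\<Sum>i\<in>J. if \<sigma> i - \<sigma> j = 0 then a i else 0)) at_top"
    by (rule mean_value_exp_sum[OF assms(1)])
  ultimately have "(\<Sum>i\<in>J. if \<sigma> i - \<sigma> j = 0 then a i else 0) = (\<Sum>i\<in>K. if \<rho> i - \<sigma> j = 0 then c i else 0)"
    by (intro tendsto_unique[OF trivial_limit_at_top_linorder])
  also have "\<dots> = 0" using none by (intro sum.neutral) auto
  also have "(\<Sum>i\<in>J. if \<sigma> i - \<sigma> j = 0 then a i else 0) = (\<Sum>i\<in>J. if i = j then a i else 0)"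
    using assms(2) j by (intro sum.cong) (auto simp: inj_on_def)
  also have "\<dots> = a j" using assms(1) j by simp
  finally show False using j by simp
qed

text \<open>
  A nontrivial relation would put all of \<open>X\<close> into the span of fewer than \<open>card I\<close> numbers, but
  \<open>X\<close> contains \<open>card I\<close> independent ones.
\<close>

lemma rationally_independent_of_dimension:
  assumes I: "finite I" and X: "finite X" and card: "card I = max_rat_independent X"
    and comb: "\<And>x. x \<in> X \<Longrightarrow> \<exists>k::nat \<Rightarrow> int. x = (\<Sum>i\<in>I. of_int (k i) * r i)"
  shows "rationally_independent_on I r"
  unfolding rationally_independent_on_def
proof (intro allI impI ballI, rule ccontr)
  fix k :: "nat \<Rightarrow> int" and i0
  assume rel: "(\<Sum>i\<in>I. of_int (k i) * r i) = 0" and i0: "i0 \<in> I" "k i0 \<noteq> 0"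
  define T where "T = r ` (I - {i0})"
  have "of_int (k i0) * r i0 + (\<Sum>i\<in>I - {i0}. of_int (k i) * r i) = 0"
    using rel I i0 by (simp add: sum.remove)
  then have "r i0 = (\<Sum>i\<in>I - {i0}. of_int (k i) * r i) * (- 1 / of_int (k i0))"
    using i0 by (simp add: field_simps)
  also have "\<dots> = (\<Sum>i\<in>I - {i0}. rat_scale (- of_int (k i) / of_int (k i0)) (r i))"
    unfolding sum_distrib_right
    by (intro sum.cong refl) (simp add: rat_scale_def of_rat_divide of_rat_minus)
  also have "\<dots> \<in> rat_real.span T"
    by (intro rat_real.span_sum rat_real.span_scale rat_real.span_base) (auto simp: T_def)
  finally have "r i0 \<in> rat_real.span T" .
  then have ri: "r i \<in> rat_real.span T" if "i \<in> I" for i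
    using that by (cases "i = i0") (auto simp: T_def intro: rat_real.span_base)
  have XT: "X \<subseteq> rat_real.span T"
  proof
    fix x assume "x \<in> X"
    then obtain c :: "nat \<Rightarrow> int" where "x = (\<Sum>i\<in>I. of_int (c i) * r i)" using comb by blast
    also have "\<dots> = (\<Sum>i\<in>I. rat_scale (of_int (c i)) (r i))" by (simp add: rat_scale_def)
    also have "\<dots> \<in> rat_real.span T"
      by (intro rat_real.span_sum rat_real.span_scale ri)
    finally show "x \<in> rat_real.span T" .
  qed
  let ?D = "{card S |S. S \<subseteq> X \<and> finite S \<and> rat_real.independent S}"
  have "?D \<subseteq> card ` Pow X" by auto
  then have "finite ?D" by (rule finite_subset) (use X in simp)
  moreover have "?D \<noteq> {}" using rat_real.independent_empty by blast
  ultimately have "Max ?D \<in> ?D" by (rule Max_in)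
  then obtain S where S: "S \<subseteq> X" "rat_real.independent S" "card S = card I"
    unfolding card max_rat_independent_def by auto
  have "card S \<le> card T"
    using rat_real.independent_span_bound[of T S] S XT I by (auto simp: T_def)
  also have "\<dots> \<le> card (I - {i0})" unfolding T_def using I by (intro card_image_le) auto
  also have "\<dots> < card I" using I i0 by (intro psubset_card_mono) auto
  finally show False using S by simp
qed

section \<open>Negative moments and almost periodicity of the logarithm\<close>

text \<open>
  With \<open>s = 1 / (4 * card J)\<close> the sublevel estimate gives tails of size \<open>K * (1 / 4) ^ n\<close>, as the
  dyadic summation requires.
\<close>

lemma exp_sum_negative_moment:
  assumes "finite J" "inj_on \<sigma> J" "j0 \<in> J" "a j0 \<noteq> 0"
  obtains s C where "0 < s" "s \<le> 1" "0 \<le> C"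
    "\<And>L \<epsilon>. 1 \<le> L \<Longrightarrow> 0 < \<epsilon> \<Longrightarrow>
       (\<integral>\<^sup>+y. ennreal (((cmod (exp_sum J a \<sigma> y))\<^sup>2 + \<epsilon>) powr - s) \<partial>mean_measure L) \<le> ennreal C"
proof -
  obtain K where K: "0 \<le> K" and
    sub: "\<And>L \<delta>. 1 \<le> L \<Longrightarrow> 0 < \<delta> \<Longrightarrow> measure lborel {y\<in>{-L..L}. cmod (exp_sum J a \<sigma> y) \<le> \<delta>}
        \<le> 2 * L * (K * \<delta> powr (1 / real (card J)))"
    by (rule exp_sum_sublevel_measure[where a = a, OF assms]) (rule that)
  have J: "card J > 0" using assms by (auto simp: card_gt_0_iff)
  define s where "s = 1 / (4 * real (card J))"
  have s: "0 < s" "s \<le> 1" using J by (auto simp: s_def)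
  have [measurable]: "exp_sum J a \<sigma> \<in> borel_measurable borel"
    by (intro borel_measurable_continuous_onI continuous_on_exp_sum)
  show ?thesis
  proof (rule that[OF s])
    show "0 \<le> 1 + 4 * K" using K by simp
    fix L \<epsilon> :: real assume L: "1 \<le> L" and \<epsilon>: "0 < \<epsilon>"
    let ?w = "\<lambda>y. ((cmod (exp_sum J a \<sigma> y))\<^sup>2 + \<epsilon>) powr - s"
    show "(\<integral>\<^sup>+y. ennreal (?w y) \<partial>mean_measure L) \<le> ennreal (1 + 4 * K)"
    proof (rule nn_integral_le_of_dyadic_tails)
      show "prob_space (mean_measure L)" using L by (intro prob_space_mean_measure) simp
      show "?w \<in> borel_measurable (mean_measure L)"
        by (intro borel_measurable_mean_measure) measurable
      show "0 \<le> K" by fact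
      fix n :: nat
      \<comment> \<open>The threshold for the modulus of the sum below which the integrand can reach \<open>2 ^ n\<close>.\<close>
      define \<delta> where "\<delta> = 2 powr (- real n / (2 * s))"
      have \<delta>: "0 < \<delta>" by (simp add: \<delta>_def)
      have imp: "cmod (exp_sum J a \<sigma> y) \<le> \<delta>" if "2 ^ n \<le> ?w y" for y
      proof -
        let ?x = "(cmod (exp_sum J a \<sigma> y))\<^sup>2 + \<epsilon>"
        have x: "0 < ?x" using \<epsilon> by (simp add: add_nonneg_pos)
        have "?x = (?w y) powr (- 1 / s)" using x s by (simp add: powr_powr)
        also have "\<dots> \<le> (2 ^ n) powr (- 1 / s)" using that s by (intro powr_mono2') auto
        also have "\<dots> = \<delta> * \<delta>"
          by (simp add: \<delta>_def powr_powr flip: powr_realpow powr_add)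
        finally have "(cmod (exp_sum J a \<sigma> y))\<^sup>2 \<le> \<delta>\<^sup>2" using \<epsilon> by (simp add: power2_eq_square)
        then show ?thesis using \<delta> by (simp add: power2_le_iff_abs_le)
      qed
      have \<delta>pow: "\<delta> powr (1 / real (card J)) = (1 / 4) ^ n"
      proof -
        have "\<delta> powr (1 / real (card J)) = 2 powr (- (2 * real n))"
          using J by (simp add: \<delta>_def powr_powr s_def mult.commute)
        also have "\<dots> = (2 powr - 2) powr real n" by (simp add: powr_powr)
        also have "\<dots> = (1 / 4) ^ n" by (simp add: powr_realpow powr_minus_divide)
        finally show ?thesis .
      qed
      let ?E = "{y. cmod (exp_sum J a \<sigma> y) \<le> \<delta>}"
      have E: "?E \<in> sets borel" by simp
      interpret P: prob_space "mean_measure L" using L by (intro prob_space_mean_measure) simp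
      have "P.prob {y \<in> space (mean_measure L). 2 ^ n \<le> ?w y} \<le> P.prob ?E"
        using imp E by (intro P.finite_measure_mono) auto
      also have "\<dots> = measure lborel {y\<in>{-L..L}. cmod (exp_sum J a \<sigma> y) \<le> \<delta>} / (2 * L)"
        using L E by (subst measure_uniform_measure) (auto simp: Int_def)
      also have "\<dots> \<le> 2 * L * (K * \<delta> powr (1 / real (card J))) / (2 * L)"
        using L by (intro divide_right_mono sub \<delta>) auto
      also have "\<dots> = K * (1 / 4) ^ n" using L by (simp add: \<delta>pow)
      finally show "P.prob {y \<in> space (mean_measure L). 2 ^ n \<le> ?w y} \<le> K * (1 / 4) ^ n" .
    qed
  qed
qed

text \<open>
  The approximating trigonometric polynomial is \<open>q(|F|\<^sup>2) / 2\<close> along the line, where the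
  polynomial \<open>q\<close> is uniformly close to \<open>ln (z + \<epsilon>)\<close>. The regularization error is small in
  mean square for all \<open>L \<ge> 1\<close> at once, and the approximation error is small everywhere.
\<close>

lemma besicovitch_almost_periodic_ln_norm:
  assumes F: "torus_trig_poly I F" and s: "0 < s" "s \<le> 1" and C: "0 \<le> C"
    and mom: "\<And>L \<epsilon>. 1 \<le> L \<Longrightarrow> 0 < \<epsilon> \<Longrightarrow>
       (\<integral>\<^sup>+y. ennreal (((cmod (F (\<lambda>i. r i * y)))\<^sup>2 + \<epsilon>) powr - s) \<partial>mean_measure L) \<le> ennreal C"
  shows "besicovitch_almost_periodic (\<lambda>y. complex_of_real (ln (cmod (F (\<lambda>i. r i * y)))))"
proof -
  define A where "A y = F (\<lambda>i. r i * y)" for y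
  define Z where "Z y = (cmod (A y))\<^sup>2" for y
  have [measurable]: "A \<in> borel_measurable borel"
    unfolding A_def by (rule torus_trig_poly_flow_measurable[OF F])
  then have [measurable]: "Z \<in> borel_measurable borel" unfolding Z_def by measurable
  obtain B where "\<And>t. cmod (F t) \<le> B" using torus_trig_poly_bounded[OF F] by blast
  then have ZB: "0 \<le> Z y" "Z y \<le> B\<^sup>2" for y by (auto simp: Z_def A_def intro: power_mono)
  \<comment> \<open>At a zero of \<open>A\<close> both sides are \<open>ln 0 = 0\<close>.\<close>
  have lnZ: "ln (cmod (A y)) = ln (Z y) / 2" for y
    by (cases "A y = 0") (auto simp: Z_def ln_realpow)
  have "\<exists>(N::nat) b s. Limsup at_top (\<lambda>L::real. ennreal (1 / (2 * L)) *
          (\<integral>\<^sup>+y\<in>{-L..L}. ennreal ((cmod (complex_of_real (ln (cmod (A y)))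
            - (\<Sum>j=1..N. b j * cis (2 * pi * s j * y))))\<^sup>2) \<partial>lebesgue)) < ennreal e"
    if e: "0 < e" for e
  proof -
    have "((\<lambda>\<epsilon>. 4 / s\<^sup>2 * \<epsilon> powr (s / 2) * (1 + C)) \<longlongrightarrow> 4 / s\<^sup>2 * 0 * (1 + C)) (at_right 0)"
      using s by (intro tendsto_intros tendsto_powr_at_right_0) auto
    then have "\<forall>\<^sub>F \<epsilon> in at_right 0. 4 / s\<^sup>2 * \<epsilon> powr (s / 2) * (1 + C) < e / 2"
      by (rule order_tendstoD) (use e in auto)
    moreover have "\<forall>\<^sub>F \<epsilon> in at_right 0. \<epsilon> \<in> {0<..<1::real}"
      by (rule eventually_at_right_real) simp
    ultimately have "\<forall>\<^sub>F \<epsilon> in at_right 0. \<epsilon> \<in> {0<..<1} \<and> 4 / s\<^sup>2 * \<epsilon> powr (s / 2) * (1 + C) < e / 2"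
      by eventually_elim auto
    then obtain \<epsilon> where \<epsilon>: "0 < \<epsilon>" "\<epsilon> \<le> 1" "4 / s\<^sup>2 * \<epsilon> powr (s / 2) * (1 + C) < e / 2"
      using eventually_happens'[of "at_right (0::real)"] by force
    define \<eta> where "\<eta> = sqrt (e / 2)"
    have \<eta>: "0 < \<eta>" "\<eta>\<^sup>2 = e / 2" using e by (auto simp: \<eta>_def)
    have "continuous_on {0..B\<^sup>2} (\<lambda>x. ln (x + \<epsilon>))" using \<epsilon> by (intro continuous_intros) auto
    then obtain q where q: "real_polynomial_function q"
      and qe: "\<And>x. x \<in> {0..B\<^sup>2} \<Longrightarrow> \<bar>ln (x + \<epsilon>) - q x\<bar> < \<eta>"
      using Stone_Weierstrass_real_polynomial_function[of "{0..B\<^sup>2}" "\<lambda>x. ln (x + \<epsilon>)" \<eta>] \<eta> by auto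
    have "torus_trig_poly I (\<lambda>t. of_real (q ((cmod (F t))\<^sup>2)) * (1 / 2))"
      by (intro torus_trig_poly_mult torus_trig_poly_const torus_trig_poly_polynomial_norm F q)
    from torus_trig_poly_flow[OF this, of r] obtain N b f where
      T: "\<And>y. of_real (q (Z y)) * (1 / 2) = (\<Sum>j=1..N::nat. b j * cis (2 * pi * f j * y))"
      unfolding Z_def A_def by blast
    let ?err = "\<lambda>y. (cmod (complex_of_real (ln (cmod (A y))) - (\<Sum>j=1..N. b j * cis (2 * pi * f j * y))))\<^sup>2"
    have err: "?err y \<le> (ln (Z y) - ln (Z y + \<epsilon>))\<^sup>2 / 2 + e / 4" for y
    proof -
      have "complex_of_real (ln (cmod (A y))) - (\<Sum>j=1..N. b j * cis (2 * pi * f j * y))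
          = complex_of_real ((ln (Z y) - q (Z y)) / 2)"
        unfolding T[symmetric] lnZ by simp
      then have "?err y = (ln (Z y) - q (Z y))\<^sup>2 / 4"
        by (simp only: norm_of_real power2_abs) (simp add: power_divide)
      moreover have "(ln (Z y) - q (Z y))\<^sup>2 \<le> 2 * (ln (Z y) - ln (Z y + \<epsilon>))\<^sup>2 + 2 * (ln (Z y + \<epsilon>) - q (Z y))\<^sup>2"
        using sum_squares_bound[of "ln (Z y) - ln (Z y + \<epsilon>)" "ln (Z y + \<epsilon>) - q (Z y)"]
        by (simp add: power2_eq_square algebra_simps)
      moreover have "(ln (Z y + \<epsilon>) - q (Z y))\<^sup>2 \<le> e / 2"
        using qe[of "Z y"] ZB[of y] \<eta> by (metis abs_le_square_iff abs_of_pos atLeastAtMost_iff less_imp_le)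
      ultimately show ?thesis by linarith
    qed
    have "ennreal (1 / (2 * L)) * (\<integral>\<^sup>+y\<in>{-L..L}. ennreal (?err y) \<partial>lebesgue) \<le> ennreal (e / 2)"
      if L: "1 \<le> L" for L
    proof -
      have P: "prob_space (mean_measure L)" using L by (intro prob_space_mean_measure) simp
      interpret prob_space "mean_measure L" by fact
      have meas: "(\<lambda>y. ennreal ((ln (Z y) - ln (Z y + \<epsilon>))\<^sup>2)) \<in> borel_measurable (mean_measure L)"
        by (intro borel_measurable_mean_measure) measurable
      have meas': "(\<lambda>y. ennreal (1 / 2) * ennreal ((ln (Z y) - ln (Z y + \<epsilon>))\<^sup>2))
          \<in> borel_measurable (mean_measure L)"
        by (intro borel_measurable_mean_measure) measurable
      have "ennreal (1 / (2 * L)) * (\<integral>\<^sup>+y\<in>{-L..L}. ennreal (?err y) \<partial>lebesgue)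
          = (\<integral>\<^sup>+y. ennreal (?err y) \<partial>mean_measure L)"
        using L by (subst nn_integral_mean_measure) (simp_all add: nn_integral_completion)
      also have "\<dots> \<le> (\<integral>\<^sup>+y. ennreal (1 / 2) * ennreal ((ln (Z y) - ln (Z y + \<epsilon>))\<^sup>2) + ennreal (e / 4) \<partial>mean_measure L)"
      proof (intro nn_integral_mono)
        fix y
        have "ennreal (?err y) \<le> ennreal (1 / 2 * (ln (Z y) - ln (Z y + \<epsilon>))\<^sup>2 + e / 4)"
          using err[of y] by (intro ennreal_leI) simp
        also have "\<dots> = ennreal (1 / 2) * ennreal ((ln (Z y) - ln (Z y + \<epsilon>))\<^sup>2) + ennreal (e / 4)"
          using e by (subst ennreal_plus, simp, simp, subst ennreal_mult) auto
        finally show "ennreal (?err y) \<le> \<dots>" .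
      qed
      also have "\<dots> = ennreal (1 / 2) * (\<integral>\<^sup>+y. ennreal ((ln (Z y) - ln (Z y + \<epsilon>))\<^sup>2) \<partial>mean_measure L) + ennreal (e / 4)"
        unfolding nn_integral_add[OF meas' borel_measurable_const] nn_integral_cmult[OF meas] nn_integral_const
            emeasure_space_1 mult_1_right ..
      also have "\<dots> \<le> ennreal (1 / 2) * ennreal (e / 2) + ennreal (e / 4)"
      proof (intro add_right_mono mult_left_mono)
        have "(\<integral>\<^sup>+y. ennreal ((ln (Z y) - ln (Z y + \<epsilon>))\<^sup>2) \<partial>mean_measure L)
            \<le> ennreal (4 / s\<^sup>2 * \<epsilon> powr (s / 2) * (1 + C))"
          by (rule regularized_ln_moments(2)[OF P _ ZB(1) s C mom[OF L, folded A_def, folded Z_def] \<epsilon>(1,2)]) simp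
        also have "\<dots> \<le> ennreal (e / 2)" using \<epsilon>(3) by (intro ennreal_leI) simp
        finally show "(\<integral>\<^sup>+y. ennreal ((ln (Z y) - ln (Z y + \<epsilon>))\<^sup>2) \<partial>mean_measure L) \<le> ennreal (e / 2)" .
      qed auto
      also have "\<dots> = ennreal (e / 2)"
        using e by (subst ennreal_mult[symmetric], simp, simp, subst ennreal_plus[symmetric]) simp_all
      finally show ?thesis .
    qed
    then have "Limsup at_top (\<lambda>L. ennreal (1 / (2 * L)) * (\<integral>\<^sup>+y\<in>{-L..L}. ennreal (?err y) \<partial>lebesgue))
        \<le> ennreal (e / 2)"
      by (intro Limsup_bounded eventually_mono[OF eventually_ge_at_top[of 1]]) auto
    also have "\<dots> < ennreal e" using e by (simp add: ennreal_less_iff)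
    finally show ?thesis by blast
  qed
  moreover have "(\<lambda>y. complex_of_real (ln (cmod (A y)))) \<in> borel_measurable lebesgue"
    by (intro measurable_completion) simp
  ultimately show ?thesis
    unfolding besicovitch_almost_periodic_def A_def by blast
qed

theorem theorem1:
  fixes lam :: real and m d :: nat and a :: "nat \<Rightarrow> complex" and \<tau> r :: "nat \<Rightarrow> real"
    and A :: "real \<Rightarrow> complex" and P :: laurent_poly
  assumes "lam \<notin> {-1..1}"
    and "m \<ge> 1"
    and "\<And>j. j \<in> {1..m} \<Longrightarrow> a j \<noteq> 0"
    and "(\<Sum>j=1..m. a j) = complex_of_real \<bar>lam\<bar>"
    and "strict_mono_on {1..m} \<tau>"
    and "\<And>y. A y = inverse (complex_of_real \<bar>lam\<bar>) * (\<Sum>j=1..m. a j * cis (2 * pi * \<tau> j * y))"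
    and "d = max_rat_independent (\<tau> ` {1..m})"
    and "laurent_vars P \<subseteq> {1..d}"
    and "\<And>y. A y = laurent_eval P (\<lambda>i. cis (2 * pi * r i * y))"
  shows "besicovitch_almost_periodic (\<lambda>y. complex_of_real (ln (cmod (A y)))) \<and>
    ((\<lambda>L. 1 / (2 * L) * (LINT y:{-L..L}|lborel. ln (cmod (A y)))) \<longlongrightarrow> ln (mahler_measure d P)) at_top"
proof -
  let ?I = "{1..d}" and ?J = "{1..m}"
  \<comment> \<open>\<open>A\<close> is the exponential sum with coefficients \<open>b\<close> and frequencies \<open>\<sigma>\<close>, and it is \<open>F\<close> along
    the line with direction \<open>r\<close>.\<close>
  define b where "b j = inverse (complex_of_real \<bar>lam\<bar>) * a j" for j
  define \<sigma> where "\<sigma> j = 2 * pi * \<tau> j" for j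
  define F where "F t = laurent_eval P (\<lambda>i. cis (2 * pi * t i))" for t
  have lam: "lam \<noteq> 0" using assms(1) by auto
  have b: "b j \<noteq> 0" if "j \<in> ?J" for j using assms(3)[OF that] lam by (simp add: b_def)
  have inj: "inj_on \<sigma> ?J"
    by (rule inj_onI) (simp add: \<sigma>_def inj_on_eq_iff[OF strict_mono_on_imp_inj_on[OF assms(5)]])
  have Aexp: "A = exp_sum ?J b \<sigma>"
    by (rule ext) (simp add: assms(6) exp_sum_def b_def \<sigma>_def sum_distrib_left mult.assoc)
  have AF: "A y = F (\<lambda>i. r i * y)" for y
    unfolding F_def assms(9) by (simp add: mult.assoc)
  have F: "torus_trig_poly ?I F"
    unfolding F_def using assms(8) by (intro torus_trig_poly_laurent_eval) auto
  have r: "rationally_independent_on ?I r"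
  proof (rule rationally_independent_of_dimension[where X = "\<tau> ` ?J"])
    fix x assume "x \<in> \<tau> ` ?J"
    then obtain j where j: "j \<in> ?J" "x = \<tau> j" by blast
    let ?\<rho> = "\<lambda>k. 2 * pi * (\<Sum>i\<in>?I. of_int (Poly_Mapping.lookup k i) * r i)"
    have "exp_sum ?J b \<sigma> y = exp_sum (Poly_Mapping.keys P) (Poly_Mapping.lookup P) ?\<rho> y" for y
    proof -
      have "(\<Sum>i\<in>?I. of_int (Poly_Mapping.lookup k i) * (r i * y))
          = (\<Sum>i\<in>?I. of_int (Poly_Mapping.lookup k i) * r i) * y" for k
        by (simp add: sum_distrib_right mult.assoc)
      then have "F (\<lambda>i. r i * y) = exp_sum (Poly_Mapping.keys P) (Poly_Mapping.lookup P) ?\<rho> y"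
        unfolding F_def laurent_eval_cis[OF assms(8) finite_atLeastAtMost] exp_sum_def
        by (simp only: mult.assoc)
      then show ?thesis by (simp only: AF flip: Aexp)
    qed
    then have "\<exists>k\<in>Poly_Mapping.keys P. ?\<rho> k = \<sigma> j"
      using inj j b by (intro exp_sum_frequency_determined) auto
    then obtain k where "?\<rho> k = \<sigma> j" by blast
    then show "\<exists>k::nat \<Rightarrow> int. x = (\<Sum>i\<in>?I. of_int (k i) * r i)"
      using j by (intro exI[of _ "Poly_Mapping.lookup k"]) (simp add: \<sigma>_def)
  qed (use assms(7) in auto)
  have one: "1 \<in> ?J" using assms(2) by simp
  obtain s C where s: "0 < s" "s \<le> 1" and C: "0 \<le> C" and
    mom: "\<And>L \<epsilon>. 1 \<le> L \<Longrightarrow> 0 < \<epsilon> \<Longrightarrow>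
       (\<integral>\<^sup>+y. ennreal (((cmod (exp_sum ?J b \<sigma> y))\<^sup>2 + \<epsilon>) powr - s) \<partial>mean_measure L) \<le> ennreal C"
    by (rule exp_sum_negative_moment[where a = b, OF finite_atLeastAtMost inj one b[OF one]]) (rule that)
  have mom: "(\<integral>\<^sup>+y. ennreal (((cmod (F (\<lambda>i. r i * y)))\<^sup>2 + \<epsilon>) powr - s) \<partial>mean_measure L) \<le> ennreal C"
    if "1 \<le> L" "0 < \<epsilon>" for L \<epsilon>
    using mom[OF that, folded Aexp] by (simp only: AF)
  have "besicovitch_almost_periodic (\<lambda>y. complex_of_real (ln (cmod (A y))))"
    unfolding AF by (rule besicovitch_almost_periodic_ln_norm[OF F s C mom])
  moreover have "((\<lambda>L. 1 / (2 * L) * (LINT y:{-L..L}|lborel. ln (cmod (A y)))) \<longlongrightarrow> ln (mahler_measure d P)) at_top"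
  proof -
    obtain B where "\<And>t. cmod (F t) \<le> B" using torus_trig_poly_bounded[OF F] by blast
    then have B: "(cmod (F t))\<^sup>2 \<le> B\<^sup>2" for t by (auto intro: power_mono)
    have W: "(\<lambda>t. (cmod (F t))\<^sup>2) \<in> borel_measurable (torus_measure ?I)"
      by (intro borel_measurable_power measurable_compose[OF torus_trig_poly_measurable[OF F]
            borel_measurable_norm])
    have [measurable]: "(\<lambda>y. F (\<lambda>i. r i * y)) \<in> borel_measurable borel"
      by (rule torus_trig_poly_flow_measurable[OF F])
    have ln2: "ln ((cmod z)\<^sup>2) = 2 * ln (cmod z)" for z
      by (cases "z = 0") (auto simp: ln_realpow)
    have "((\<lambda>L. \<integral>y. ln ((cmod (F (\<lambda>i. r i * y)))\<^sup>2) \<partial>mean_measure L)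
        \<longlongrightarrow> (\<integral>t. ln ((cmod (F t))\<^sup>2) \<partial>torus_measure ?I)) at_top"
    proof (rule tendsto_integral_ln[where B = "B\<^sup>2", OF _ _ _ W _ B _ B s C mom])
      fix \<phi> :: "real \<Rightarrow> real" assume "continuous_on {0..B\<^sup>2} \<phi>"
      then show "((\<lambda>L. \<integral>y. \<phi> ((cmod (F (\<lambda>i. r i * y)))\<^sup>2) \<partial>mean_measure L)
          \<longlongrightarrow> (\<integral>t. \<phi> ((cmod (F t))\<^sup>2) \<partial>torus_measure ?I)) at_top"
        by (intro equidistribution_norm_trig_poly[OF _ r F B]) auto
    qed (auto intro: prob_space_torus_measure prob_space_mean_measure)
    then have "((\<lambda>L. (\<integral>y. 2 * ln (cmod (A y)) \<partial>mean_measure L) / 2)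
        \<longlongrightarrow> (\<integral>t. 2 * ln (cmod (F t)) \<partial>torus_measure ?I) / 2) at_top"
      unfolding ln2 AF by (intro tendsto_divide tendsto_const) auto
    moreover have "(\<integral>t. 2 * ln (cmod (F t)) \<partial>torus_measure ?I) / 2 = ln (mahler_measure d P)"
      by (simp add: mahler_measure_def F_def)
    ultimately have "((\<lambda>L. \<integral>y. ln (cmod (A y)) \<partial>mean_measure L) \<longlongrightarrow> ln (mahler_measure d P)) at_top"
      by simp
    then show ?thesis
    proof (rule Lim_transform_eventually)
      show "\<forall>\<^sub>F L in at_top. (\<integral>y. ln (cmod (A y)) \<partial>mean_measure L)
          = 1 / (2 * L) * (LINT y:{-L..L}|lborel. ln (cmod (A y)))"
        using eventually_gt_at_top[of 0]
        by eventually_elim (subst integral_mean_measure, simp_all add: AF)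
    qed
  qed
  ultimately show ?thesis ..
qed

end
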